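(* Let Assumptions 1 and 2 (stated in the context) hold, let $F$ have Lipschitz continuous gradient, and let $\mathcal X=\mathbb R^n$. Let $\{(x_k,y_k)\}$ be generated by the accelerated SCGD algorithm (defined in the context) with stepsizes $\alpha_k=k^{-5/7}$, $\beta_k=k^{-4/7}$ for $k\ge1$ (and $\alpha_0,\beta_0\in(0,1]$ arbitrary). For $\epsilon>0$ let $$T_\epsilon=\min\Big\{k:\ \inf_{0\le t\le k}\mathbf E[\|\nabla F(x_t)\|^2]\le\epsilon\Big\}.$$ Then $T_\epsilon\le\mathcal O(\epsilon^{-7/2})$, i.e. there is a constant $c>0$ independent of $\epsilon$ such that $T_\epsilon\le c\,\epsilon^{-7/2}$ for all $\epsilon\in(0,1]$.
   Context: Problem. Minimize $F(x)=f(g(x))$ over $x\in\mathcal X=\mathbb R^n$, where $f:\mathbb R^m\to\mathbb R$, $g:\mathbb R^n\to\mathbb R^m$ are differentiable, $f(y)=\mathbf E[f_v(y)]$, $g(x)=\mathbf E[g_w(x)]$ with $f_v,g_w$ differentiable, and $(w,v)$ is a pair of (possibly dependent) random variables. Standing assumption: the problem has at least one optimal solution $x^*$. $\|\cdot\|$ is the Euclidean norm (operator norm for matrices). $\nabla g_w(x)\in\mathbb R^{n\times m}$ (and likewise $\nabla g(x)$) has as $j$-th column the gradient of the $j$-th component. Assumption 1 (with $\mathcal X=\mathbb R^n$, $F$ differentiable). There are positive scalars $C_g,C_f,V_g,L_f$ such that: (i) $f$ is continuously differentiable and $g$ is continuous. (ii) $(w_0,v_0),(w_1,v_1),\dots$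 are i.i.d. (copies of $(w,v)$), and with probability 1, for all $x\in\mathbb R^n$, $\mathbf E[g_{w_0}(x)\mid v_0]=g(x)$ and $\mathbf E[\nabla g_{w_0}(x)\nabla f_{v_0}(g(x))\mid v_0]=\nabla F(x)$. (iii) $g$ is Lipschitz continuous with parameter $C_g$, and with probability 1, for all $x\in\mathbb R^n$, $\mathbf E[\|\nabla g_{w_0}(x)\|^2\mid v_0]\le C_g$ and $\mathbf E[\|g_{w_0}(x)-g(x)\|^2\mid v_0]\le V_g$. (iv) With probability 1, for all $y,\bar y\in\mathbb R^m$, $\mathbf E[\|\nabla f_{v_0}(y)\|^2\mid w_0]\le C_f$ and $\|\nabla f_{v_0}(y)-\nabla f_{v_0}(\bar y)\|\le L_f\|y-\bar y\|$; $f$ likewise has Lipschitz continuous gradient. Assumption 2. There is $L_g>0$ with $\|\nabla g(x)-\nabla g(y)\|\le L_g\|x-y\|$ for all $x,y\in\mathbb R^n$; and with probability 1, $\mathbf E[\|\nabla g_{w_0}(x)\|^4\mid v_0]\le C_g^2$ for all $x\in\mathbb R^n$ and $\mathbf E[\|\nabla f_{v_0}(y)\|^4\mid w_0]\le C_f^2$ for all $y\in\mathbb R^m$. Accelerated SCGD algorithm (with $\mathcal X=\mathbb R^n$, so no projection). Given deterministic $x_0\in\mathbb R^n$, $y_0\in\mathbb R^m$ and stepsizes $\alpha_k,\beta_k\in(0,1]$, for $k=0,1,2,\dots$: $$x_{k+1}=x_k-\alpha_k\nabla g_{w_k}(x_k)\nabla f_{v_k}(y_k),\quad z_{k+1}=-\Big(\frac1{\beta_k}-1\Big)x_k+\frac1{\beta_k}x_{k+1},\quad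 y_{k+1}=(1-\beta_k)y_k+\beta_kg_{w_{k+1}}(z_{k+1}).$$ *)

theory Defs
  imports "HOL-Probability.Probability"
begin

definition grad :: "(real ^ 'n \<Rightarrow> real) \<Rightarrow> real ^ 'n \<Rightarrow> real ^ 'n" where
  "grad h x = (THE D. GDERIV h x :> D)"

(* The n x m matrix whose j-th column is the gradient of the j-th component of h,
   i.e. the transpose of the Jacobian. *)
definition grad_matrix :: "(real ^ 'n \<Rightarrow> real ^ 'm) \<Rightarrow> real ^ 'n \<Rightarrow> real ^ 'm ^ 'n" where
  "grad_matrix h x = (\<chi> i j. grad (\<lambda>u. h u $ j) x $ i)"

(* Euclidean operator norm; the library's norm on real ^ 'm ^ 'n is the Frobenius norm. *)
definition op_norm :: "real ^ 'm ^ 'n \<Rightarrow> real" where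
  "op_norm A = onorm (\<lambda>u. A *v u)"

definition vec_cond_exp ::
    "'a measure \<Rightarrow> 'a measure \<Rightarrow> ('a \<Rightarrow> real ^ 'k) \<Rightarrow> 'a \<Rightarrow> real ^ 'k" where
  "vec_cond_exp M G X \<omega> = (\<chi> i. real_cond_exp M G (\<lambda>\<eta>. X \<eta> $ i) \<omega>)"

definition sigma_gen :: "'a measure \<Rightarrow> 'b measure \<Rightarrow> ('a \<Rightarrow> 'b) \<Rightarrow> 'a measure" where
  "sigma_gen M N X = vimage_algebra (space M) X N"

(* W and V only contribute their sigma-algebras: they are the value spaces of the random
   variables w k and v k. The generic pair (w, v) has the law of (w 0, v 0).
   Since gw a and fv b are continuous, measurability in the index for each fixed argument
   already gives joint measurability, so that all iterates are random variables. *)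
definition composition_problem ::
    "'a measure \<Rightarrow> 'w measure \<Rightarrow> 'v measure \<Rightarrow> (nat \<Rightarrow> 'a \<Rightarrow> 'w) \<Rightarrow> (nat \<Rightarrow> 'a \<Rightarrow> 'v) \<Rightarrow>
     ('w \<Rightarrow> real ^ 'n \<Rightarrow> real ^ 'm) \<Rightarrow> ('v \<Rightarrow> real ^ 'm \<Rightarrow> real) \<Rightarrow>
     (real ^ 'n \<Rightarrow> real ^ 'm) \<Rightarrow> (real ^ 'm \<Rightarrow> real) \<Rightarrow> bool" where
  "composition_problem M W V w v gw fv g f \<longleftrightarrow>
     prob_space M \<and>
     w 0 \<in> measurable M W \<and> v 0 \<in> measurable M V \<and>
     (\<forall>a \<in> space W. \<forall>x. gw a differentiable (at x)) \<and>
     (\<forall>b \<in> space V. \<forall>y. fv b differentiable (at y)) \<and>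
     (\<forall>x. (\<lambda>a. gw a x) \<in> borel_measurable W) \<and>
     (\<forall>y. (\<lambda>b. fv b y) \<in> borel_measurable V) \<and>
     (\<forall>x. g differentiable (at x)) \<and>
     (\<forall>y. f differentiable (at y)) \<and>
     (\<forall>x. integrable M (\<lambda>\<omega>. gw (w 0 \<omega>) x) \<and> g x = (\<integral>\<omega>. gw (w 0 \<omega>) x \<partial>M)) \<and>
     (\<forall>y. integrable M (\<lambda>\<omega>. fv (v 0 \<omega>) y) \<and> f y = (\<integral>\<omega>. fv (v 0 \<omega>) y \<partial>M)) \<and>
     (\<exists>xopt. \<forall>x. f (g xopt) \<le> f (g x))"

(* A conditional expectation is determined only up to a null set for each x, so a condition
   on it holding "with probability 1 for all x" means that versions can be chosen for which
   it does. As the right-hand sides are deterministic, this is equivalent to the condition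
   holding almost surely for each x, which is the form used here: overwrite each version by
   its bound (or by the prescribed value) wherever it violates the condition.
   The Lipschitz condition on grad (fv b) involves no conditional expectation and holds for
   all y, y' outside one null set.
   Moments are conditioned with nn_cond_exp, which takes the value infinity where
   real_cond_exp would be 0 by convention. *)
definition scgd_assumption1 ::
    "'a measure \<Rightarrow> 'w measure \<Rightarrow> 'v measure \<Rightarrow> (nat \<Rightarrow> 'a \<Rightarrow> 'w) \<Rightarrow> (nat \<Rightarrow> 'a \<Rightarrow> 'v) \<Rightarrow>
     ('w \<Rightarrow> real ^ 'n \<Rightarrow> real ^ 'm) \<Rightarrow> ('v \<Rightarrow> real ^ 'm \<Rightarrow> real) \<Rightarrow>
     (real ^ 'n \<Rightarrow> real ^ 'm) \<Rightarrow> (real ^ 'm \<Rightarrow> real) \<Rightarrow>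
     real \<Rightarrow> real \<Rightarrow> real \<Rightarrow> real \<Rightarrow> bool" where
  "scgd_assumption1 M W V w v gw fv g f Cg Cf Vg Lf \<longleftrightarrow>
     0 < Cg \<and> 0 < Cf \<and> 0 < Vg \<and> 0 < Lf \<and>
     (\<forall>y. f differentiable (at y)) \<and> continuous_on UNIV (grad f) \<and> continuous_on UNIV g \<and>
     prob_space.indep_vars M (\<lambda>_. W \<Otimes>\<^sub>M V) (\<lambda>k \<omega>. (w k \<omega>, v k \<omega>)) UNIV \<and>
     (\<forall>k. distr M (W \<Otimes>\<^sub>M V) (\<lambda>\<omega>. (w k \<omega>, v k \<omega>)) = distr M (W \<Otimes>\<^sub>M V) (\<lambda>\<omega>. (w 0 \<omega>, v 0 \<omega>))) \<and>
     (\<forall>x. AE \<omega> in M.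
        vec_cond_exp M (sigma_gen M V (v 0)) (\<lambda>\<eta>. gw (w 0 \<eta>) x) \<omega> = g x) \<and>
     (\<forall>x. AE \<omega> in M.
        vec_cond_exp M (sigma_gen M V (v 0))
          (\<lambda>\<eta>. grad_matrix (gw (w 0 \<eta>)) x *v grad (fv (v 0 \<eta>)) (g x)) \<omega>
        = grad (\<lambda>u. f (g u)) x) \<and>
     Cg-lipschitz_on UNIV g \<and>
     (\<forall>x. AE \<omega> in M.
        nn_cond_exp M (sigma_gen M V (v 0))
          (\<lambda>\<eta>. ennreal ((op_norm (grad_matrix (gw (w 0 \<eta>)) x))\<^sup>2)) \<omega> \<le> ennreal Cg) \<and>
     (\<forall>x. AE \<omega> in M.
        nn_cond_exp M (sigma_gen M V (v 0))
          (\<lambda>\<eta>. ennreal ((norm (gw (w 0 \<eta>) x - g x))\<^sup>2)) \<omega> \<le> ennreal Vg) \<and>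
     (\<forall>y. AE \<omega> in M.
        nn_cond_exp M (sigma_gen M W (w 0))
          (\<lambda>\<eta>. ennreal ((norm (grad (fv (v 0 \<eta>)) y))\<^sup>2)) \<omega> \<le> ennreal Cf) \<and>
     (AE \<omega> in M. \<forall>y y'.
        norm (grad (fv (v 0 \<omega>)) y - grad (fv (v 0 \<omega>)) y') \<le> Lf * norm (y - y')) \<and>
     Lf-lipschitz_on UNIV (grad f)"

definition scgd_assumption2 ::
    "'a measure \<Rightarrow> 'w measure \<Rightarrow> 'v measure \<Rightarrow> (nat \<Rightarrow> 'a \<Rightarrow> 'w) \<Rightarrow> (nat \<Rightarrow> 'a \<Rightarrow> 'v) \<Rightarrow>
     ('w \<Rightarrow> real ^ 'n \<Rightarrow> real ^ 'm) \<Rightarrow> ('v \<Rightarrow> real ^ 'm \<Rightarrow> real) \<Rightarrow>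
     (real ^ 'n \<Rightarrow> real ^ 'm) \<Rightarrow> real \<Rightarrow> real \<Rightarrow> bool" where
  "scgd_assumption2 M W V w v gw fv g Cg Cf \<longleftrightarrow>
     (\<exists>Lg > 0. \<forall>x x'. op_norm (grad_matrix g x - grad_matrix g x') \<le> Lg * norm (x - x')) \<and>
     (\<forall>x. AE \<omega> in M.
        nn_cond_exp M (sigma_gen M V (v 0))
          (\<lambda>\<eta>. ennreal ((op_norm (grad_matrix (gw (w 0 \<eta>)) x)) ^ 4)) \<omega> \<le> ennreal (Cg\<^sup>2)) \<and>
     (\<forall>y. AE \<omega> in M.
        nn_cond_exp M (sigma_gen M W (w 0))
          (\<lambda>\<eta>. ennreal ((norm (grad (fv (v 0 \<eta>)) y)) ^ 4)) \<omega> \<le> ennreal (Cf\<^sup>2))"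

(* The value z 0 is irrelevant and left unconstrained. *)
definition accelerated_scgd ::
    "'a measure \<Rightarrow> (nat \<Rightarrow> 'a \<Rightarrow> 'w) \<Rightarrow> (nat \<Rightarrow> 'a \<Rightarrow> 'v) \<Rightarrow>
     ('w \<Rightarrow> real ^ 'n \<Rightarrow> real ^ 'm) \<Rightarrow> ('v \<Rightarrow> real ^ 'm \<Rightarrow> real) \<Rightarrow>
     (nat \<Rightarrow> real) \<Rightarrow> (nat \<Rightarrow> real) \<Rightarrow> real ^ 'n \<Rightarrow> real ^ 'm \<Rightarrow>
     (nat \<Rightarrow> 'a \<Rightarrow> real ^ 'n) \<Rightarrow> (nat \<Rightarrow> 'a \<Rightarrow> real ^ 'm) \<Rightarrow> (nat \<Rightarrow> 'a \<Rightarrow> real ^ 'n) \<Rightarrow> bool" where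
  "accelerated_scgd M w v gw fv \<alpha> \<beta> x0 y0 x y z \<longleftrightarrow>
     (\<forall>\<omega> \<in> space M. x 0 \<omega> = x0 \<and> y 0 \<omega> = y0 \<and>
       (\<forall>k.
         x (Suc k) \<omega> = x k \<omega>
           - \<alpha> k *\<^sub>R (grad_matrix (gw (w k \<omega>)) (x k \<omega>) *v grad (fv (v k \<omega>)) (y k \<omega>)) \<and>
         z (Suc k) \<omega> = - ((1 / \<beta> k - 1) *\<^sub>R x k \<omega>) + (1 / \<beta> k) *\<^sub>R x (Suc k) \<omega> \<and>
         y (Suc k) \<omega> = (1 - \<beta> k) *\<^sub>R y k \<omega> + \<beta> k *\<^sub>R gw (w (Suc k) \<omega>) (z (Suc k) \<omega>)))"

(* Taken in enat, so the minimum is infinite when no index qualifies. *)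
definition T_eps ::
    "'a measure \<Rightarrow> (real ^ 'n \<Rightarrow> real) \<Rightarrow> (nat \<Rightarrow> 'a \<Rightarrow> real ^ 'n) \<Rightarrow> real \<Rightarrow> enat" where
  "T_eps M F x \<epsilon> =
     Inf {enat k | k. (INF t\<in>{0..k}. \<integral>\<^sup>+\<omega>. ennreal ((norm (grad F (x t \<omega>)))\<^sup>2) \<partial>M) \<le> ennreal \<epsilon>}"

end

(* Let e(k) = y(k) - g(x(k)) and d(k) = x(k) - x(k+1).  Since x(k+1) is the convex combination of
   x(k) and z(k+1) with weight beta(k), the linear terms cancel in
   (1 - beta) g(x(k)) + beta g(z(k+1)) - g(x(k+1)), which is therefore O(|d(k)|^2 / beta).  The
   fourth moment of d(k) is O(alpha^4) and the sampling noise of g is a martingale difference, so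
   E|e(k+1)|^2 <= (1 - beta) E|e(k)|^2 + O(alpha^4 / beta^3 + beta^2); with the given stepsizes
   both error terms equal beta^2 up to constants, whence E|e(k)|^2 = O(beta(k)).  The descent
   inequality for F then bounds sum alpha(k) E|grad F(x(k))|^2, because alpha^2 and alpha beta are
   summable, while the sum of alpha(k) over k <= K is at least K^(2/7). *)

theory Submission
  imports Defs
begin

text \<open>Two dependences shape the argument: \<open>w k\<close> and \<open>v k\<close> may be
  dependent, and \<open>y k\<close> is built from \<open>w k\<close>, so the gradient of
  \<open>fv\<close> is evaluated at a point correlated with the matrix that multiplies it. The
  moments of the direction are therefore bounded by conditioning on \<open>w 0\<close>, which makes
  the matrix and the argument known at once. Expectations over the iterates are computed by freezing
  the past: the state before step k and the sample k have a product law, so the inner integral runs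
  over \<open>sample 0\<close> at fixed arguments, which is where the assumptions apply. No
  conditional expectation given the past is ever formed. Unbiasedness holds only for the direction
  evaluated at \<open>g (x k)\<close>. Using \<open>y k\<close> instead costs a term proportional to
  |e(k)|, and half of E|grad F(x(k))|^2 is spent to absorb it. The bound E|e(k)|^2 = O(beta(k))
  rests on 4/7 < 1: from k to k+1, beta loses at most the fraction (4/7) beta(k), less than the
  fraction beta(k) by which the recursion contracts, and the remaining 3/7 pays for the error
  terms.\<close>

section \<open>Gradients: existence, second-order remainder, difference quotients\<close>

text \<open>The derivative is the inner product with its adjoint applied to 1, and uniqueness of
  derivatives makes the definite description in \<open>grad\<close> denote that vector.\<close>

lemma GDERIV_grad:
  fixes h :: "real ^ 'n \<Rightarrow> real"
  assumes "h differentiable (at x)"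
  shows "GDERIV h x :> grad h x"
proof -
  obtain h' where h': "(h has_derivative h') (at x)"
    using assms by (auto simp: differentiable_def)
  then have "linear h'"
    by (rule has_derivative_linear)
  have "h' = (\<lambda>u. inner u (adjoint h' 1))"
    using adjoint_works[OF \<open>linear h'\<close>] by (auto simp: inner_commute)
  then have ex: "GDERIV h x :> adjoint h' 1"
    using h' by (simp add: gderiv_def)
  moreover have "D = adjoint h' 1" if "GDERIV h x :> D" for D
  proof -
    have "(\<lambda>u. inner u D) = (\<lambda>u. inner u (adjoint h' 1))"
      using that ex unfolding gderiv_def by (rule has_derivative_unique)
    then show ?thesis
      by (metis vector_eq_ldot)
  qed
  ultimately show ?thesis
    unfolding grad_def by (metis (mono_tags) theI')
qed

text \<open>The mean value theorem on the segment from \<open>a\<close> to \<open>b\<close> yields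
  one intermediate point, whose distance to \<open>a\<close> is bounded by the whole length of the
  segment. This gives the constant \<open>L\<close>; integrating along the segment would give
  \<open>L / 2\<close>, which would change only constants later.\<close>

lemma grad_lipschitz_remainder_le:
  fixes h :: "real ^ 'n \<Rightarrow> real"
  assumes d: "\<And>x. h differentiable (at x)"
    and L: "\<And>x y. norm (grad h x - grad h y) \<le> L * norm (x - y)" "0 \<le> L"
  shows "\<bar>h b - h a - inner (grad h a) (b - a)\<bar> \<le> L * (norm (b - a))\<^sup>2"
proof -
  define p where "p t = a + t *\<^sub>R (b - a)" for t :: real
  have der: "((\<lambda>t. h (p t)) has_derivative (\<lambda>s. inner (s *\<^sub>R (b - a)) (grad h (p t)))) (at t within {0..1})" for t
  proof -
    have "(p has_derivative (\<lambda>s. s *\<^sub>R (b - a))) (at t within {0..1})"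
      unfolding p_def[abs_def] by (auto intro!: derivative_eq_intros)
    moreover have "(h has_derivative (\<lambda>u. inner u (grad h (p t)))) (at (p t))"
      using GDERIV_grad[OF d] by (simp add: gderiv_def)
    ultimately show ?thesis
      by (rule has_derivative_compose[rotated, of h, simplified comp_def, rotated])
  qed
  obtain t where t: "t \<in> {0<..<1}" "h (p 1) - h (p 0) = inner ((1 - 0 :: real) *\<^sub>R (b - a)) (grad h (p t))"
    using mvt_simple[of 0 1, OF _ der] by auto
  then have "h b - h a - inner (grad h a) (b - a) = inner (b - a) (grad h (p t) - grad h a)"
    by (simp add: p_def inner_diff_right inner_commute)
  also have "\<bar>\<dots>\<bar> \<le> norm (b - a) * norm (grad h (p t) - grad h a)"
    by (rule Cauchy_Schwarz_ineq2)
  also have "\<dots> \<le> norm (b - a) * (L * norm (p t - a))"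
    using L by (intro mult_left_mono) auto
  also have "\<dots> \<le> norm (b - a) * (L * norm (b - a))"
    using t L by (intro mult_left_mono) (auto simp: p_def mult_left_le_one_le)
  finally show ?thesis
    by (simp add: power2_eq_square mult_ac)
qed

text \<open>Exhibits a partial derivative as the limit of a sequence of difference quotients; this
  countable limit is what makes gradients measurable in the random index.\<close>

lemma grad_nth_LIMSEQ:
  fixes h :: "real ^ 'n \<Rightarrow> real"
  assumes "h differentiable (at x)"
  shows "(\<lambda>n. (h (x + (1 / real (Suc n)) *\<^sub>R axis i 1) - h x) * real (Suc n)) \<longlonglongrightarrow> grad h x $ i"
proof -
  have "((\<lambda>t::real. x + t *\<^sub>R axis i 1) has_derivative (\<lambda>t. t *\<^sub>R axis i 1)) (at 0)"
    by (auto intro!: derivative_eq_intros)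
  moreover have "(h has_derivative (\<lambda>u. inner u (grad h x))) (at (x + 0 *\<^sub>R axis i (1::real)))"
    using GDERIV_grad[OF assms] by (simp add: gderiv_def)
  ultimately have "((\<lambda>t::real. h (x + t *\<^sub>R axis i 1)) has_derivative (\<lambda>t. inner (t *\<^sub>R axis i 1) (grad h x))) (at 0)"
    by (rule has_derivative_compose[rotated, of h, simplified comp_def, rotated])
  then have "((\<lambda>t::real. h (x + t *\<^sub>R axis i 1)) has_field_derivative grad h x $ i) (at 0)"
    by (simp add: has_field_derivative_def inner_axis' mult_commute_abs)
  then have "((\<lambda>t::real. (h (x + t *\<^sub>R axis i 1) - h x) / t) \<longlongrightarrow> grad h x $ i) (at 0)"
    by (simp add: DERIV_def)
  moreover have "filterlim (\<lambda>n. 1 / real (Suc n)) (at 0) sequentially"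
    using LIMSEQ_inverse_real_of_nat by (simp add: filterlim_at inverse_eq_divide)
  ultimately have "(\<lambda>n. (h (x + (1 / real (Suc n)) *\<^sub>R axis i 1) - h x) / (1 / real (Suc n))) \<longlonglongrightarrow> grad h x $ i"
    by (rule filterlim_compose)
  then show ?thesis
    by simp
qed

section \<open>Joint measurability in the random index and the argument\<close>

lemma borel_measurable_vecI:
  fixes f :: "'a \<Rightarrow> 'b::euclidean_space ^ 'n"
  assumes "\<And>i. (\<lambda>x. f x $ i) \<in> borel_measurable M"
  shows "f \<in> borel_measurable M"
  using assms by (subst borel_measurable_euclidean_space) (auto simp: Basis_vec_def inner_axis)

lemma borel_measurable_vec_nth [measurable (raw)]:
  fixes f :: "'a \<Rightarrow> 'b::euclidean_space ^ 'n"
  assumes "f \<in> borel_measurable M"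
  shows "(\<lambda>x. f x $ i) \<in> borel_measurable M"
  using assms by (rule borel_measurable_continuous_on[rotated]) (intro continuous_intros)

lemma borel_measurable_matrix_vector_mult [measurable (raw)]:
  fixes f :: "'a \<Rightarrow> real ^ 'm ^ 'n"
  assumes [measurable]: "f \<in> borel_measurable M" "u \<in> borel_measurable M"
  shows "(\<lambda>x. f x *v u x) \<in> borel_measurable M"
  by (rule borel_measurable_vecI) (simp add: matrix_vector_mult_def)

text \<open>Simple functions \<open>s i\<close> converging pointwise to the identity replace the
  argument by one with finitely many values, for which measurability in \<open>a\<close> alone
  suffices; continuity in the argument passes to the limit.\<close>

lemma borel_measurable_caratheodory:
  fixes h :: "'a \<Rightarrow> 'b::{metric_space, second_countable_topology} \<Rightarrow> 'c::metric_space"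
  assumes cont: "\<And>a. a \<in> space W \<Longrightarrow> continuous_on UNIV (h a)"
    and meas: "\<And>x. (\<lambda>a. h a x) \<in> borel_measurable W"
  shows "(\<lambda>(a, x). h a x) \<in> borel_measurable (W \<Otimes>\<^sub>M borel)"
proof -
  obtain s :: "nat \<Rightarrow> 'b \<Rightarrow> 'b" where s: "\<And>i. simple_function borel (s i)"
      "\<And>x. (\<lambda>i. s i x) \<longlonglongrightarrow> x"
    using borel_measurable_implies_sequence_metric[of "\<lambda>x. x" borel undefined] by auto
  show ?thesis
  proof (rule borel_measurable_LIMSEQ_metric)
    fix i
    have fin: "finite (range (s i))"
      using s(1)[of i] by (auto simp: simple_function_def)
    have "(\<lambda>p. s i (snd p)) \<in> measurable (W \<Otimes>\<^sub>M borel) (count_space (range (s i)))"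
      using measurable_simple_function[OF s(1)[of i]]
      by (intro measurable_compose[OF measurable_snd])
        (auto simp: measurable_def)
    then have "(\<lambda>p. h (fst p) (s i (snd p))) \<in> borel_measurable (W \<Otimes>\<^sub>M borel)"
      by (rule measurable_compose_countable'[rotated])
        (auto intro: measurable_compose[OF measurable_fst meas] countable_finite[OF fin])
    then show "(\<lambda>(a, x). h a (s i x)) \<in> borel_measurable (W \<Otimes>\<^sub>M borel)"
      by (simp add: case_prod_beta')
  next
    fix p assume "p \<in> space (W \<Otimes>\<^sub>M (borel :: 'b measure))"
    then have "isCont (h (fst p)) (snd p)"
      using cont[of "fst p"] by (auto simp: space_pair_measure continuous_on_eq_continuous_at)
    then have "(\<lambda>i. h (fst p) (s i (snd p))) \<longlonglongrightarrow> h (fst p) (snd p)"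
      using s(2) by (rule isCont_tendsto_compose)
    then show "(\<lambda>i. case p of (a, x) \<Rightarrow> h a (s i x)) \<longlonglongrightarrow> (case p of (a, x) \<Rightarrow> h a x)"
      by (simp add: case_prod_beta')
  qed
qed

lemma borel_measurable_grad:
  fixes h :: "'a \<Rightarrow> real ^ 'n \<Rightarrow> real"
  assumes diff: "\<And>a x. a \<in> space W \<Longrightarrow> h a differentiable (at x)"
    and meas: "\<And>x. (\<lambda>a. h a x) \<in> borel_measurable W"
  shows "(\<lambda>(a, x). grad (h a) x) \<in> borel_measurable (W \<Otimes>\<^sub>M borel)"
proof (rule borel_measurable_vecI)
  fix i
  have [measurable]: "(\<lambda>(a, x). h a x) \<in> borel_measurable (W \<Otimes>\<^sub>M borel)"
    by (intro borel_measurable_caratheodory meas)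
      (simp add: continuous_on_eq_continuous_at differentiable_imp_continuous_within diff)
  have "(\<lambda>p. (h (fst p) (snd p + (1 / real (Suc n)) *\<^sub>R axis i 1) - h (fst p) (snd p)) * real (Suc n))
      \<in> borel_measurable (W \<Otimes>\<^sub>M borel)" for n
    by measurable
  then have "(\<lambda>p. grad (h (fst p)) (snd p) $ i) \<in> borel_measurable (W \<Otimes>\<^sub>M borel)"
    by (rule borel_measurable_LIMSEQ_real[rotated])
      (auto simp: space_pair_measure intro!: grad_nth_LIMSEQ diff simp del: of_nat_Suc)
  then show "(\<lambda>p. (case p of (a, x) \<Rightarrow> grad (h a) x) $ i) \<in> borel_measurable (W \<Otimes>\<^sub>M borel)"
    by (simp add: case_prod_beta')
qed

lemma differentiable_vec_nth:
  assumes "h differentiable (at x)"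
  shows "(\<lambda>u. h u $ j) differentiable (at x)"
  using assms unfolding differentiable_def
  by (auto intro: bounded_linear.has_derivative[OF bounded_linear_vec_nth])

lemma borel_measurable_grad_matrix:
  fixes h :: "'a \<Rightarrow> real ^ 'n \<Rightarrow> real ^ 'm"
  assumes diff: "\<And>a x. a \<in> space W \<Longrightarrow> h a differentiable (at x)"
    and meas: "\<And>x. (\<lambda>a. h a x) \<in> borel_measurable W"
  shows "(\<lambda>(a, x). grad_matrix (h a) x) \<in> borel_measurable (W \<Otimes>\<^sub>M borel)"
proof (intro borel_measurable_vecI)
  fix i j
  have [measurable]: "(\<lambda>(a, x). grad (\<lambda>u. h a u $ j) x) \<in> borel_measurable (W \<Otimes>\<^sub>M borel)"
    by (intro borel_measurable_grad differentiable_vec_nth diff borel_measurable_vec_nth meas)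
  show "(\<lambda>p. (case p of (a, x) \<Rightarrow> grad_matrix (h a) x) $ i $ j) \<in> borel_measurable (W \<Otimes>\<^sub>M borel)"
    by (simp add: grad_matrix_def case_prod_beta')
qed

section \<open>The operator norm\<close>

lemma op_norm_nonneg: "0 \<le> op_norm A"
  unfolding op_norm_def by (intro onorm_pos_le matrix_vector_mul_bounded_linear)

lemma norm_matrix_vector_mult_le: "norm (A *v u) \<le> op_norm A * norm u"
  unfolding op_norm_def by (intro onorm matrix_vector_mul_bounded_linear)

text \<open>A gradient of a component is a column of \<open>grad_matrix\<close>, that is, its value
  at a unit vector. So the Lipschitz condition on the matrix in the operator norm becomes one on
  each component gradient.\<close>

lemma norm_column_grad_le_op_norm:
  "norm (grad (\<lambda>u. h u $ j) x - grad (\<lambda>u. h u $ j) x') \<le> op_norm (grad_matrix h x - grad_matrix h x')"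
proof -
  have "grad (\<lambda>u. h u $ j) x - grad (\<lambda>u. h u $ j) x' = (grad_matrix h x - grad_matrix h x') *v axis j 1"
    by (simp add: vec_eq_iff grad_matrix_def matrix_vector_mult_basis column_def)
  also have "norm \<dots> \<le> op_norm (grad_matrix h x - grad_matrix h x') * norm (axis j (1::real))"
    by (rule norm_matrix_vector_mult_le)
  finally show ?thesis
    by simp
qed

text \<open>A finite convex function on a finite-dimensional space is continuous, so no comparison
  with the Frobenius norm is required.\<close>

lemma borel_measurable_op_norm [measurable]: "op_norm \<in> borel_measurable borel"
proof (rule borel_measurable_continuous_onI, rule convex_on_continuous)
  show "convex_on UNIV (op_norm :: real ^ 'm ^ 'n \<Rightarrow> real)"
  proof (rule convex_onI)
    fix t :: real and A B :: "real ^ 'm ^ 'n"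
    assume t: "0 < t" "t < 1"
    have "op_norm ((1 - t) *\<^sub>R A + t *\<^sub>R B) = onorm (\<lambda>u. ((1 - t) *\<^sub>R (A *v u)) + t *\<^sub>R (B *v u))"
      by (simp add: op_norm_def matrix_vector_mult_add_rdistrib scaleR_matrix_vector_assoc)
    also have "\<dots> \<le> onorm (\<lambda>u. (1 - t) *\<^sub>R (A *v u)) + onorm (\<lambda>u. t *\<^sub>R (B *v u))"
      by (intro onorm_triangle bounded_linear_intros matrix_vector_mul_bounded_linear)
    also have "\<dots> = (1 - t) * op_norm A + t * op_norm B"
      using t by (simp add: onorm_scaleR op_norm_def)
    finally show "op_norm ((1 - t) *\<^sub>R A + t *\<^sub>R B) \<le> (1 - t) * op_norm A + t * op_norm B" .
  qed simp
qed simp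

section \<open>Independence and freezing of the past\<close>

text \<open>The library's \<^const>\<open>prob_space.indep_var\<close> requires both variables to have the same type.\<close>

definition (in prob_space) indep_pair ::
    "'b measure \<Rightarrow> ('a \<Rightarrow> 'b) \<Rightarrow> 'c measure \<Rightarrow> ('a \<Rightarrow> 'c) \<Rightarrow> bool" where
  "indep_pair L X N Y \<longleftrightarrow> X \<in> measurable M L \<and> Y \<in> measurable M N \<and>
    distr M L X \<Otimes>\<^sub>M distr M N Y = distr M (L \<Otimes>\<^sub>M N) (\<lambda>\<omega>. (X \<omega>, Y \<omega>))"

lemma (in prob_space) indep_pair_compose:
  assumes "indep_pair L X N Y" and p [measurable]: "p \<in> measurable L L'" and q [measurable]: "q \<in> measurable N N'"
  shows "indep_pair L' (\<lambda>\<omega>. p (X \<omega>)) N' (\<lambda>\<omega>. q (Y \<omega>))"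
proof -
  have [measurable]: "X \<in> measurable M L" "Y \<in> measurable M N"
    and eq: "distr M L X \<Otimes>\<^sub>M distr M N Y = distr M (L \<Otimes>\<^sub>M N) (\<lambda>\<omega>. (X \<omega>, Y \<omega>))"
    using assms by (auto simp: indep_pair_def)
  interpret Y: prob_space "distr M N' (\<lambda>\<omega>. q (Y \<omega>))"
    by (rule prob_space_distr) measurable
  have "distr M L' (\<lambda>\<omega>. p (X \<omega>)) \<Otimes>\<^sub>M distr M N' (\<lambda>\<omega>. q (Y \<omega>))
      = distr (distr M L X) L' p \<Otimes>\<^sub>M distr (distr M N Y) N' q"
    by (simp add: distr_distr comp_def)
  also have "\<dots> = distr (distr M L X \<Otimes>\<^sub>M distr M N Y) (L' \<Otimes>\<^sub>M N') (\<lambda>(a, b). (p a, q b))"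
    by (rule pair_measure_distr) (simp_all add: distr_distr comp_def Y.sigma_finite_measure_axioms)
  also have "\<dots> = distr M (L' \<Otimes>\<^sub>M N') (\<lambda>\<omega>. (p (X \<omega>), q (Y \<omega>)))"
    unfolding eq by (simp add: distr_distr comp_def)
  finally show ?thesis
    by (simp add: indep_pair_def)
qed

text \<open>\<open>Q k\<close> is a measurable function of the samples with index below
  \<open>k\<close>, and disjoint blocks of an independent family are independent.\<close>

lemma (in prob_space) indep_pair_recursion:
  assumes ind: "indep_vars (\<lambda>_. N) S UNIV"
    and q0: "q0 \<in> space L" "\<And>\<omega>. \<omega> \<in> space M \<Longrightarrow> Q 0 \<omega> = q0"
    and Phi [measurable]: "\<And>k. \<Phi> k \<in> measurable (L \<Otimes>\<^sub>M N) L"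
    and rec: "\<And>k \<omega>. \<omega> \<in> space M \<Longrightarrow> Q (Suc k) \<omega> = \<Phi> k (Q k \<omega>, S k \<omega>)"
  shows "indep_pair L (Q k) N (S k)"
proof -
  have "\<exists>q. q \<in> measurable (PiM {..<k} (\<lambda>_. N)) L \<and>
      (\<forall>\<omega>\<in>space M. Q k \<omega> = q (restrict (\<lambda>i. S i \<omega>) {..<k}))"
  proof (induction k)
    case 0
    show ?case
      using q0 by (intro exI[of _ "\<lambda>_. q0"]) auto
  next
    case (Suc k)
    then obtain q where [measurable]: "q \<in> measurable (PiM {..<k} (\<lambda>_. N)) L"
      and q: "\<And>\<omega>. \<omega> \<in> space M \<Longrightarrow> Q k \<omega> = q (restrict (\<lambda>i. S i \<omega>) {..<k})"
      by blast
    have [measurable]: "(\<lambda>s. restrict s {..<k}) \<in> measurable (PiM {..<Suc k} (\<lambda>_. N)) (PiM {..<k} (\<lambda>_. N))"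
      by (rule measurable_restrict_subset) auto
    have [measurable]: "(\<lambda>s. s k) \<in> measurable (PiM {..<Suc k} (\<lambda>_. N)) N"
      by (rule measurable_component_singleton) auto
    have "(\<lambda>s. \<Phi> k (q (restrict s {..<k}), s k)) \<in> measurable (PiM {..<Suc k} (\<lambda>_. N)) L"
      by measurable
    moreover have "(\<lambda>i\<in>{..<k}. if i < Suc k then S i \<omega> else undefined) = (\<lambda>i\<in>{..<k}. S i \<omega>)" for \<omega>
      by (auto simp: fun_eq_iff restrict_def)
    ultimately show ?case
      using rec q by (intro exI[of _ "\<lambda>s. \<Phi> k (q (restrict s {..<k}), s k)"]) simp
  qed
  then obtain q where q: "q \<in> measurable (PiM {..<k} (\<lambda>_. N)) L"
    and Q: "\<forall>\<omega>\<in>space M. Q k \<omega> = q (restrict (\<lambda>i. S i \<omega>) {..<k})"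
    by (elim exE conjE)
  have "indep_pair (PiM {..<k} (\<lambda>_. N)) (\<lambda>\<omega>. restrict (\<lambda>i. S i \<omega>) {..<k})
      (PiM {k} (\<lambda>_. N)) (\<lambda>\<omega>. restrict (\<lambda>i. S i \<omega>) {k})"
    unfolding indep_pair_def indep_var_distribution_eq[symmetric]
    by (rule indep_var_restrict[OF ind]) auto
  then have "indep_pair L (\<lambda>\<omega>. q (restrict (\<lambda>i. S i \<omega>) {..<k})) N (\<lambda>\<omega>. (restrict (\<lambda>i. S i \<omega>) {k}) k)"
    using q by (rule indep_pair_compose) (rule measurable_component_singleton, simp)
  then have "indep_pair L (\<lambda>\<omega>. q (restrict (\<lambda>i. S i \<omega>) {..<k})) N (S k)"
    by simp
  moreover have "random_variable L (Q k) \<longleftrightarrow> random_variable L (\<lambda>\<omega>. q (restrict (\<lambda>i. S i \<omega>) {..<k}))"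
    using Q by (intro measurable_cong) auto
  moreover have "distr M L (Q k) = distr M L (\<lambda>\<omega>. q (restrict (\<lambda>i. S i \<omega>) {..<k}))"
      "distr M (L \<Otimes>\<^sub>M N) (\<lambda>\<omega>. (Q k \<omega>, S k \<omega>))
        = distr M (L \<Otimes>\<^sub>M N) (\<lambda>\<omega>. (q (restrict (\<lambda>i. S i \<omega>) {..<k}), S k \<omega>))"
    using Q by (auto intro!: distr_cong)
  ultimately show ?thesis
    by (simp only: indep_pair_def)
qed

text \<open>Tonelli for the product law of \<open>(X, Y)\<close>, with \<open>Y\<close> replaced by
  the equally distributed \<open>Y0\<close>. It does the work of conditioning on \<open>X\<close>:
  in the inner integral \<open>X\<close> is frozen, and \<open>Y0\<close> will be the sample of
  index 0, for which the assumptions are stated.\<close>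

lemma (in prob_space) nn_integral_indep_copy:
  assumes ind: "indep_pair L X N Y" and Y0 [measurable]: "Y0 \<in> measurable M N"
    and distr: "distr M N Y = distr M N Y0"
    and h [measurable]: "h \<in> borel_measurable (L \<Otimes>\<^sub>M N)"
  shows "(\<integral>\<^sup>+\<omega>. h (X \<omega>, Y \<omega>) \<partial>M) = (\<integral>\<^sup>+\<omega>. \<integral>\<^sup>+\<omega>'. h (X \<omega>, Y0 \<omega>') \<partial>M \<partial>M)"
proof -
  have [measurable]: "X \<in> measurable M L" "Y \<in> measurable M N"
    using ind by (auto simp: indep_pair_def)
  interpret Y0: prob_space "distr M N Y0"
    by (rule prob_space_distr) simp
  have "(\<integral>\<^sup>+\<omega>. h (X \<omega>, Y \<omega>) \<partial>M) = (\<integral>\<^sup>+p. h p \<partial>distr M (L \<Otimes>\<^sub>M N) (\<lambda>\<omega>. (X \<omega>, Y \<omega>)))"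
    by (simp add: nn_integral_distr)
  also have "\<dots> = (\<integral>\<^sup>+p. h p \<partial>(distr M L X \<Otimes>\<^sub>M distr M N Y0))"
    using ind by (simp add: indep_pair_def distr)
  also have "\<dots> = (\<integral>\<^sup>+q. \<integral>\<^sup>+s. h (q, s) \<partial>distr M N Y0 \<partial>distr M L X)"
    by (intro Y0.nn_integral_fst[symmetric]) simp
  also have "\<dots> = (\<integral>\<^sup>+\<omega>. \<integral>\<^sup>+s. h (X \<omega>, s) \<partial>distr M N Y0 \<partial>M)"
    by (intro nn_integral_distr) (simp_all add: Y0.borel_measurable_nn_integral)
  also have "\<dots> = (\<integral>\<^sup>+\<omega>. \<integral>\<^sup>+\<omega>'. h (X \<omega>, Y0 \<omega>') \<partial>M \<partial>M)"
    by (intro nn_integral_cong nn_integral_distr) auto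
  finally show ?thesis .
qed

text \<open>The signed version rests on Fubini; the integrability it needs on the product is carried
  over from \<open>M\<close> by the equality of laws.\<close>

lemma (in prob_space) integral_indep_copy:
  fixes h :: "_ \<Rightarrow> real"
  assumes ind: "indep_pair L X N Y" and Y0 [measurable]: "Y0 \<in> measurable M N"
    and distr: "distr M N Y = distr M N Y0"
    and h [measurable]: "h \<in> borel_measurable (L \<Otimes>\<^sub>M N)"
    and int: "integrable M (\<lambda>\<omega>. h (X \<omega>, Y \<omega>))"
  shows "(\<integral>\<omega>. h (X \<omega>, Y \<omega>) \<partial>M) = (\<integral>\<omega>. \<integral>\<omega>'. h (X \<omega>, Y0 \<omega>') \<partial>M \<partial>M)"
proof -
  have [measurable]: "X \<in> measurable M L" "Y \<in> measurable M N"
    using ind by (auto simp: indep_pair_def)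
  interpret X: prob_space "distr M L X"
    by (rule prob_space_distr) simp
  interpret Y0: prob_space "distr M N Y0"
    by (rule prob_space_distr) simp
  interpret XY: pair_sigma_finite "distr M L X" "distr M N Y0" ..
  have eq: "distr M (L \<Otimes>\<^sub>M N) (\<lambda>\<omega>. (X \<omega>, Y \<omega>)) = distr M L X \<Otimes>\<^sub>M distr M N Y0"
    using ind by (simp add: indep_pair_def distr)
  have "(\<integral>\<omega>. h (X \<omega>, Y \<omega>) \<partial>M) = (\<integral>p. h p \<partial>(distr M L X \<Otimes>\<^sub>M distr M N Y0))"
    unfolding eq[symmetric] by (simp add: integral_distr)
  also have "\<dots> = (\<integral>q. \<integral>s. h (q, s) \<partial>distr M N Y0 \<partial>distr M L X)"
    using int by (intro XY.integral_fst'[symmetric]) (simp add: integrable_distr_eq flip: eq)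
  also have "\<dots> = (\<integral>\<omega>. \<integral>s. h (X \<omega>, s) \<partial>distr M N Y0 \<partial>M)"
    by (intro integral_distr) (simp_all add: Y0.borel_measurable_lebesgue_integral)
  also have "\<dots> = (\<integral>\<omega>. \<integral>\<omega>'. h (X \<omega>, Y0 \<omega>') \<partial>M \<partial>M)"
    by (intro Bochner_Integration.integral_cong refl integral_distr) auto
  finally show ?thesis .
qed

section \<open>From conditional bounds to integrals\<close>

lemma (in prob_space) finite_measure_subalgebra_sigma_gen:
  assumes "X \<in> measurable M N"
  shows "finite_measure_subalgebra M (sigma_gen M N X)"
proof
  show "subalgebra M (sigma_gen M N X)"
    using assms by (auto simp: subalgebra_def sigma_gen_def sets_vimage_algebra2 measurable_space
        intro!: measurable_sets)
qed

text \<open>The weight \<open>A (X \<omega>)\<close> is measurable for the sigma-algebra of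
  \<open>X\<close>, so by the defining property of the conditional expectation \<open>h\<close> may
  be replaced by it under the integral.\<close>

lemma (in prob_space) nn_integral_le_of_nn_cond_exp_le:
  assumes X [measurable]: "X \<in> measurable M N" and h [measurable]: "h \<in> borel_measurable M"
    and A [measurable]: "A \<in> borel_measurable N"
    and le: "AE \<omega> in M. nn_cond_exp M (sigma_gen M N X) h \<omega> \<le> C"
  shows "(\<integral>\<^sup>+\<omega>. A (X \<omega>) * h \<omega> \<partial>M) \<le> C * (\<integral>\<^sup>+\<omega>. A (X \<omega>) \<partial>M)"
proof -
  interpret finite_measure_subalgebra M "sigma_gen M N X"
    by (rule finite_measure_subalgebra_sigma_gen) simp
  have "X \<in> measurable (sigma_gen M N X) N"
    unfolding sigma_gen_def using measurable_space[OF X] by (intro measurable_vimage_algebra1) auto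
  then have "(\<lambda>\<omega>. A (X \<omega>)) \<in> borel_measurable (sigma_gen M N X)"
    by simp
  then have "(\<integral>\<^sup>+\<omega>. A (X \<omega>) * h \<omega> \<partial>M) = (\<integral>\<^sup>+\<omega>. A (X \<omega>) * nn_cond_exp M (sigma_gen M N X) h \<omega> \<partial>M)"
    by (intro nn_cond_exp_intg[symmetric]) simp_all
  also have "\<dots> \<le> (\<integral>\<^sup>+\<omega>. C * A (X \<omega>) \<partial>M)"
    using le by (intro nn_integral_mono_AE) (auto simp: mult.commute[of C] intro!: mult_left_mono)
  also have "\<dots> = C * (\<integral>\<^sup>+\<omega>. A (X \<omega>) \<partial>M)"
    by (rule nn_integral_cmult) simp
  finally show ?thesis .
qed

text \<open>The bound on the conditional moment for each fixed argument passes to arguments that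
  depend on the conditioning variable: first for simple \<^term>\<open>P\<close>, then by Fatou's lemma.\<close>

lemma (in prob_space) nn_integral_le_of_nn_cond_exp_le_random:
  fixes \<psi> :: "'v \<Rightarrow> 'y::{metric_space, second_countable_topology} \<Rightarrow> real"
  assumes X [measurable]: "X \<in> measurable M W" and Y [measurable]: "Y \<in> measurable M V"
    and \<psi> [measurable]: "(\<lambda>(b, y). \<psi> b y) \<in> borel_measurable (V \<Otimes>\<^sub>M borel)"
    and nonneg: "\<And>b y. 0 \<le> \<psi> b y"
    and cont: "AE \<omega> in M. continuous_on UNIV (\<psi> (Y \<omega>))"
    and le: "\<And>y. AE \<omega> in M. nn_cond_exp M (sigma_gen M W X) (\<lambda>\<eta>. ennreal (\<psi> (Y \<eta>) y)) \<omega> \<le> C"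
    and A [measurable]: "A \<in> borel_measurable W" and A_nonneg: "\<And>a. 0 \<le> A a"
    and P [measurable]: "P \<in> borel_measurable W"
  shows "(\<integral>\<^sup>+\<omega>. ennreal (A (X \<omega>) * \<psi> (Y \<omega>) (P (X \<omega>))) \<partial>M) \<le> C * (\<integral>\<^sup>+\<omega>. ennreal (A (X \<omega>)) \<partial>M)"
proof -
  have simple: "(\<integral>\<^sup>+\<omega>. ennreal (A (X \<omega>) * \<psi> (Y \<omega>) (s (X \<omega>))) \<partial>M) \<le> C * (\<integral>\<^sup>+\<omega>. ennreal (A (X \<omega>)) \<partial>M)"
    if s: "simple_function W s" for s
  proof -
    have fin: "finite (s ` space W)"
      using s by (simp add: simple_function_def)
    \<comment> \<open>\<open>I c\<close> is the indicator of the level set where \<open>s\<close>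
      equals \<open>c\<close>. There the random argument is the constant \<open>c\<close>, so
      \<open>le\<close> applies with the weight \<open>I c * A\<close>.\<close>
    define I where "I c a = (indicator (s -` {c} \<inter> space W) a :: ennreal)" for c a
    have [measurable]: "I c \<in> borel_measurable W" for c
      unfolding I_def using simple_functionD(2)[OF s] by simp
    have I: "(\<Sum>c\<in>s ` space W. I c (X \<omega>) * u c) = u (s (X \<omega>))" if "\<omega> \<in> space M" for \<omega> and u :: "'y \<Rightarrow> ennreal"
    proof -
      have "X \<omega> \<in> space W"
        using that X by (rule measurable_space[rotated])
      then have "(\<Sum>c\<in>s ` space W. I c (X \<omega>) * u c) = (\<Sum>c\<in>{s (X \<omega>)}. I c (X \<omega>) * u c)"
        using fin by (intro sum.mono_neutral_right) (auto simp: I_def split: split_indicator)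
      then show ?thesis
        using \<open>X \<omega> \<in> space W\<close> by (simp add: I_def)
    qed
    have "(\<integral>\<^sup>+\<omega>. ennreal (A (X \<omega>) * \<psi> (Y \<omega>) (s (X \<omega>))) \<partial>M)
        = (\<integral>\<^sup>+\<omega>. (\<Sum>c\<in>s ` space W. I c (X \<omega>) * ennreal (A (X \<omega>)) * ennreal (\<psi> (Y \<omega>) c)) \<partial>M)"
      by (intro nn_integral_cong) (simp add: mult.assoc I ennreal_mult nonneg A_nonneg)
    also have "\<dots> = (\<Sum>c\<in>s ` space W. \<integral>\<^sup>+\<omega>. I c (X \<omega>) * ennreal (A (X \<omega>)) * ennreal (\<psi> (Y \<omega>) c) \<partial>M)"
      by (intro nn_integral_sum) measurable
    also have "\<dots> \<le> (\<Sum>c\<in>s ` space W. C * (\<integral>\<^sup>+\<omega>. I c (X \<omega>) * ennreal (A (X \<omega>)) \<partial>M))"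
      by (intro sum_mono nn_integral_le_of_nn_cond_exp_le[where A="\<lambda>a. I _ a * ennreal (A a)", OF X _ _ le])
        measurable
    also have "\<dots> = C * (\<integral>\<^sup>+\<omega>. (\<Sum>c\<in>s ` space W. I c (X \<omega>) * ennreal (A (X \<omega>))) \<partial>M)"
      by (subst nn_integral_sum) (simp_all add: sum_distrib_left)
    also have "\<dots> = C * (\<integral>\<^sup>+\<omega>. ennreal (A (X \<omega>)) \<partial>M)"
      by (intro arg_cong[where f="\<lambda>u. C * u"] nn_integral_cong) (simp add: I)
    finally show ?thesis .
  qed
  obtain s where s: "\<And>i. simple_function W (s i)" "\<And>a. a \<in> space W \<Longrightarrow> (\<lambda>i. s i a) \<longlonglongrightarrow> P a"
    using borel_measurable_implies_sequence_metric[OF P, of undefined] by auto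
  have [measurable]: "s i \<in> borel_measurable W" for i
    using s(1) by (rule borel_measurable_simple_function)
  have "(\<integral>\<^sup>+\<omega>. ennreal (A (X \<omega>) * \<psi> (Y \<omega>) (P (X \<omega>))) \<partial>M)
      = (\<integral>\<^sup>+\<omega>. liminf (\<lambda>i. ennreal (A (X \<omega>) * \<psi> (Y \<omega>) (s i (X \<omega>)))) \<partial>M)"
  \<comment> \<open>Continuity of \<open>\<psi> (Y \<omega>)\<close> turns convergence of the simple
    approximations into convergence of the integrands; it holds only almost surely, hence the
    equality up to a null set.\<close>
  proof (rule nn_integral_cong_AE, use cont AE_space in eventually_elim)
    case (elim \<omega>)
    then have "(\<lambda>i. \<psi> (Y \<omega>) (s i (X \<omega>))) \<longlonglongrightarrow> \<psi> (Y \<omega>) (P (X \<omega>))"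
      using s(2)[OF measurable_space[OF X]]
      by (intro isCont_tendsto_compose[of _ "\<psi> (Y \<omega>)"]) (auto simp: continuous_on_eq_continuous_at)
    then have "(\<lambda>i. ennreal (A (X \<omega>) * \<psi> (Y \<omega>) (s i (X \<omega>)))) \<longlonglongrightarrow> ennreal (A (X \<omega>) * \<psi> (Y \<omega>) (P (X \<omega>)))"
      by (intro tendsto_ennrealI tendsto_mult_left)
    then show "ennreal (A (X \<omega>) * \<psi> (Y \<omega>) (P (X \<omega>))) = liminf (\<lambda>i. ennreal (A (X \<omega>) * \<psi> (Y \<omega>) (s i (X \<omega>))))"
      by (intro lim_imp_Liminf[symmetric]) auto
  qed
  also have "\<dots> \<le> liminf (\<lambda>i. \<integral>\<^sup>+\<omega>. ennreal (A (X \<omega>) * \<psi> (Y \<omega>) (s i (X \<omega>))) \<partial>M)"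
    by (intro nn_integral_liminf) measurable
  also have "\<dots> \<le> liminf (\<lambda>i. C * (\<integral>\<^sup>+\<omega>. ennreal (A (X \<omega>)) \<partial>M))"
    by (intro Liminf_mono always_eventually allI simple s)
  also have "\<dots> = C * (\<integral>\<^sup>+\<omega>. ennreal (A (X \<omega>)) \<partial>M)"
    by (intro lim_imp_Liminf) auto
  finally show ?thesis .
qed

text \<open>Freezing applied to the indicator \<open>h\<close> of the failure of \<open>P\<close>:
  each inner integral vanishes, hence so does the whole.\<close>

lemma (in prob_space) AE_indep_copy:
  assumes ind: "indep_pair L X N Y" and Y0 [measurable]: "Y0 \<in> measurable M N"
    and distr: "distr M N Y = distr M N Y0"
    and P [measurable]: "Measurable.pred (L \<Otimes>\<^sub>M N) P"
    and AE: "\<And>\<omega>. \<omega> \<in> space M \<Longrightarrow> AE \<omega>' in M. P (X \<omega>, Y0 \<omega>')"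
  shows "AE \<omega> in M. P (X \<omega>, Y \<omega>)"
proof -
  have [measurable]: "X \<in> measurable M L" "Y \<in> measurable M N"
    using ind by (auto simp: indep_pair_def)
  define h where "h p = (if P p then 0 else 1 :: ennreal)" for p
  have [measurable]: "h \<in> borel_measurable (L \<Otimes>\<^sub>M N)"
    unfolding h_def[abs_def] by measurable
  have "(\<integral>\<^sup>+\<omega>. h (X \<omega>, Y \<omega>) \<partial>M) = (\<integral>\<^sup>+\<omega>. \<integral>\<^sup>+\<omega>'. h (X \<omega>, Y0 \<omega>') \<partial>M \<partial>M)"
    using ind Y0 distr by (rule nn_integral_indep_copy) simp
  also have "\<dots> = (\<integral>\<^sup>+\<omega>. 0 \<partial>M)"
  proof (rule nn_integral_cong)
    fix \<omega> assume "\<omega> \<in> space M"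
    then have "(\<integral>\<^sup>+\<omega>'. h (X \<omega>, Y0 \<omega>') \<partial>M) = (\<integral>\<^sup>+\<omega>'. 0 \<partial>M)"
      using AE[of \<omega>] by (intro nn_integral_cong_AE) (auto simp: h_def)
    then show "(\<integral>\<^sup>+\<omega>'. h (X \<omega>, Y0 \<omega>') \<partial>M) = 0"
      by simp
  qed
  finally have "AE \<omega> in M. h (X \<omega>, Y \<omega>) = 0"
    by (simp add: nn_integral_0_iff_AE)
  then show ?thesis
    by (auto simp: h_def split: if_splits)
qed

section \<open>Integrability and quadratic inequalities\<close>

lemma integrable_of_nn_integral_le:
  assumes [measurable]: "f \<in> borel_measurable M" and "\<And>x. 0 \<le> f x"
    and "(\<integral>\<^sup>+x. ennreal (f x) \<partial>M) \<le> ennreal K" and "0 \<le> K"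
  shows "integrable M f" "(\<integral>x. f x \<partial>M) \<le> K"
proof -
  show int: "integrable M f"
    using assms by (intro integrableI_bounded) (auto intro: le_less_trans)
  have "ennreal (\<integral>x. f x \<partial>M) = (\<integral>\<^sup>+x. ennreal (f x) \<partial>M)"
    using assms by (intro nn_integral_eq_integral[symmetric] int) auto
  then show "(\<integral>x. f x \<partial>M) \<le> K"
    using assms by (metis ennreal_le_iff)
qed

lemma le_one_plus_power2: "t \<le> 1 + t\<^sup>2" for t :: real
  using zero_le_power2[of "t - 1 / 2"] by (simp add: power2_diff field_simps power2_eq_square)

lemma (in finite_measure) integrable_of_norm_power2:
  fixes X :: "'a \<Rightarrow> 'b::{banach, second_countable_topology}"
  assumes [measurable]: "X \<in> borel_measurable M" and int: "integrable M (\<lambda>\<omega>. (norm (X \<omega>))\<^sup>2)"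
  shows "integrable M X"
proof (rule Bochner_Integration.integrable_bound)
  show "integrable M (\<lambda>\<omega>. 1 + (norm (X \<omega>))\<^sup>2)"
    using int by simp
  show "AE \<omega> in M. norm (X \<omega>) \<le> norm (1 + (norm (X \<omega>))\<^sup>2)"
    by (simp add: abs_of_nonneg add_nonneg_nonneg le_one_plus_power2)
qed simp

text \<open>The gap between the two sides is t (1 - t) |a - b|^2. Convexity keeps the factor
  \<open>1 - t\<close> in front of |a|^2, which splitting a cross term would enlarge.\<close>

lemma norm_convex_comb_power2_le:
  fixes a b :: "'c::real_inner"
  assumes "0 \<le> t" "t \<le> 1"
  shows "(norm ((1 - t) *\<^sub>R a + t *\<^sub>R b))\<^sup>2 \<le> (1 - t) * (norm a)\<^sup>2 + t * (norm b)\<^sup>2"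
proof -
  have "(1 - t) * (norm a)\<^sup>2 + t * (norm b)\<^sup>2 - (norm ((1 - t) *\<^sub>R a + t *\<^sub>R b))\<^sup>2
      = t * (1 - t) * (norm (a - b))\<^sup>2"
    unfolding power2_norm_eq_inner by (simp add: inner_simps inner_commute algebra_simps)
  then show ?thesis
    using assms by (metis diff_ge_0_iff_ge mult_nonneg_nonneg zero_le_power2)
qed

lemma abs_inner_le_half_power2:
  "\<bar>inner a b\<bar> \<le> (norm a)\<^sup>2 / 2 + (norm b)\<^sup>2 / 2"
proof -
  have "\<bar>inner a b\<bar> \<le> norm a * norm b"
    by (rule Cauchy_Schwarz_ineq2)
  then show ?thesis
    using zero_le_power2[of "norm a - norm b"] by (simp add: power2_diff field_simps)
qed

lemma integrable_inner_of_norm_power2: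
  fixes X Y :: "'a \<Rightarrow> 'b::euclidean_space"
  assumes [measurable]: "X \<in> borel_measurable M" "Y \<in> borel_measurable M"
    and "integrable M (\<lambda>\<omega>. (norm (X \<omega>))\<^sup>2)" "integrable M (\<lambda>\<omega>. (norm (Y \<omega>))\<^sup>2)"
  shows "integrable M (\<lambda>\<omega>. inner (X \<omega>) (Y \<omega>))"
proof (rule Bochner_Integration.integrable_bound)
  show "integrable M (\<lambda>\<omega>. (norm (X \<omega>))\<^sup>2 / 2 + (norm (Y \<omega>))\<^sup>2 / 2)"
    using assms by simp
  show "AE \<omega> in M. norm (inner (X \<omega>) (Y \<omega>)) \<le> norm ((norm (X \<omega>))\<^sup>2 / 2 + (norm (Y \<omega>))\<^sup>2 / 2)"
    using abs_inner_le_half_power2[of "X _" "Y _"] by (auto intro!: AE_I2 order_trans[OF _ abs_ge_self])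
qed simp

section \<open>The setting and its consequences for a single sample\<close>

locale accelerated_scgd_setup =
  fixes M :: "'a measure" and W :: "'w measure" and V :: "'v measure"
    and w :: "nat \<Rightarrow> 'a \<Rightarrow> 'w" and v :: "nat \<Rightarrow> 'a \<Rightarrow> 'v"
    and gw :: "'w \<Rightarrow> real ^ 'n \<Rightarrow> real ^ 'm" and fv :: "'v \<Rightarrow> real ^ 'm \<Rightarrow> real"
    and g :: "real ^ 'n \<Rightarrow> real ^ 'm" and f :: "real ^ 'm \<Rightarrow> real" and F :: "real ^ 'n \<Rightarrow> real"
    and Cg Cf Vg Lf LF :: real and \<alpha> \<beta> :: "nat \<Rightarrow> real"
    and x0 :: "real ^ 'n" and y0 :: "real ^ 'm"
    and x z :: "nat \<Rightarrow> 'a \<Rightarrow> real ^ 'n" and y :: "nat \<Rightarrow> 'a \<Rightarrow> real ^ 'm"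
  assumes problem: "composition_problem M W V w v gw fv g f"
    and F_eq: "\<And>u. F u = f (g u)"
    and a1: "scgd_assumption1 M W V w v gw fv g f Cg Cf Vg Lf"
    and a2: "scgd_assumption2 M W V w v gw fv g Cg Cf"
    and gradF_lipschitz: "LF-lipschitz_on UNIV (grad F)"
    and \<alpha>_pos: "\<And>k. 0 < \<alpha> k"
    and \<beta>_pos: "\<And>k. 0 < \<beta> k" and \<beta>_le_1: "\<And>k. \<beta> k \<le> 1"
    and iterates: "accelerated_scgd M w v gw fv \<alpha> \<beta> x0 y0 x y z"

sublocale accelerated_scgd_setup \<subseteq> prob_space M
  using problem by (simp add: composition_problem_def)

context accelerated_scgd_setup
begin

lemma constants_pos: "0 < Cg" "0 < Cf" "0 < Vg" "0 < Lf"
  using a1 by (auto simp: scgd_assumption1_def)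

lemma LF_nonneg: "0 \<le> LF"
  using gradF_lipschitz by (rule lipschitz_on_nonneg)

lemma gw_differentiable: "a \<in> space W \<Longrightarrow> gw a differentiable (at u)"
  and fv_differentiable: "b \<in> space V \<Longrightarrow> fv b differentiable (at t)"
  and g_differentiable: "g differentiable (at u)"
  and f_differentiable: "f differentiable (at t)"
  and gw_section_measurable: "(\<lambda>a. gw a u) \<in> borel_measurable W"
  and fv_section_measurable: "(\<lambda>b. fv b t) \<in> borel_measurable V"
  and gw_integrable: "integrable M (\<lambda>\<omega>. gw (w 0 \<omega>) u)"
  and gw_integral: "(\<integral>\<omega>. gw (w 0 \<omega>) u \<partial>M) = g u"
  using problem unfolding composition_problem_def by auto

lemma F_bounded_below: "\<exists>m. \<forall>u. m \<le> F u"
  using problem unfolding composition_problem_def F_eq by blast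

lemma F_differentiable: "F differentiable (at u)"
proof -
  have "(f \<circ> g) differentiable (at u)"
    by (intro differentiable_chain_at g_differentiable f_differentiable)
  moreover have "F = f \<circ> g"
    by (auto simp: F_eq)
  ultimately show ?thesis
    by simp
qed

definition sample :: "nat \<Rightarrow> 'a \<Rightarrow> 'w \<times> 'v" where
  "sample k \<omega> = (w k \<omega>, v k \<omega>)"

lemma sample_indep: "indep_vars (\<lambda>_. W \<Otimes>\<^sub>M V) sample UNIV"
  and sample_distr: "distr M (W \<Otimes>\<^sub>M V) (sample k) = distr M (W \<Otimes>\<^sub>M V) (sample 0)"
  using a1 unfolding scgd_assumption1_def sample_def[abs_def] by blast+

lemma sample_measurable [measurable]: "sample k \<in> measurable M (W \<Otimes>\<^sub>M V)"
  using sample_indep by (auto simp: indep_vars_def)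

lemma w_measurable [measurable]: "w k \<in> measurable M W"
  and v_measurable [measurable]: "v k \<in> measurable M V"
  using measurable_compose[OF sample_measurable measurable_fst, of k]
    measurable_compose[OF sample_measurable measurable_snd, of k]
  by (simp_all add: sample_def)

lemma gw_measurable [measurable (raw)]:
  assumes "a \<in> measurable N W" "u \<in> borel_measurable N"
  shows "(\<lambda>\<omega>. gw (a \<omega>) (u \<omega>)) \<in> borel_measurable N"
proof -
  have "(\<lambda>(a, u). gw a u) \<in> borel_measurable (W \<Otimes>\<^sub>M borel)"
    by (intro borel_measurable_caratheodory gw_section_measurable)
      (simp add: continuous_on_eq_continuous_at differentiable_imp_continuous_within gw_differentiable)
  from measurable_compose[OF measurable_Pair[OF assms] this] show ?thesis
    by simp
qed

lemma grad_gw_measurable [measurable (raw)]: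
  assumes "a \<in> measurable N W" "u \<in> borel_measurable N"
  shows "(\<lambda>\<omega>. grad_matrix (gw (a \<omega>)) (u \<omega>)) \<in> borel_measurable N"
proof -
  have "(\<lambda>(a, u). grad_matrix (gw a) u) \<in> borel_measurable (W \<Otimes>\<^sub>M borel)"
    by (intro borel_measurable_grad_matrix gw_section_measurable gw_differentiable)
  from measurable_compose[OF measurable_Pair[OF assms] this] show ?thesis
    by simp
qed

lemma grad_fv_measurable [measurable (raw)]:
  assumes "b \<in> measurable N V" "t \<in> borel_measurable N"
  shows "(\<lambda>\<omega>. grad (fv (b \<omega>)) (t \<omega>)) \<in> borel_measurable N"
proof -
  have "(\<lambda>(b, t). grad (fv b) t) \<in> borel_measurable (V \<Otimes>\<^sub>M borel)"
    by (intro borel_measurable_grad fv_section_measurable fv_differentiable)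
  from measurable_compose[OF measurable_Pair[OF assms] this] show ?thesis
    by simp
qed

lemma g_measurable [measurable]: "g \<in> borel_measurable borel"
  by (intro borel_measurable_continuous_onI)
    (simp add: continuous_on_eq_continuous_at differentiable_imp_continuous_within g_differentiable)

lemma F_measurable [measurable]: "F \<in> borel_measurable borel"
  by (intro borel_measurable_continuous_onI)
    (simp add: continuous_on_eq_continuous_at differentiable_imp_continuous_within F_differentiable)

lemma grad_F_measurable [measurable]: "grad F \<in> borel_measurable borel"
  using gradF_lipschitz by (intro borel_measurable_continuous_onI lipschitz_on_continuous_on)

lemma nn_integral_le_of_nn_cond_exp_v_le:
  assumes "h \<in> borel_measurable M"
    and "AE \<omega> in M. nn_cond_exp M (sigma_gen M V (v 0)) h \<omega> \<le> C"
  shows "(\<integral>\<^sup>+\<omega>. h \<omega> \<partial>M) \<le> C"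
  using nn_integral_le_of_nn_cond_exp_le[OF v_measurable assms(1) borel_measurable_const[of 1] assms(2)]
  by (simp add: emeasure_space_1)

lemma op_norm_moment:
  "(\<integral>\<^sup>+\<omega>. ennreal ((op_norm (grad_matrix (gw (w 0 \<omega>)) u))\<^sup>2) \<partial>M) \<le> ennreal Cg"
  "(\<integral>\<^sup>+\<omega>. ennreal ((op_norm (grad_matrix (gw (w 0 \<omega>)) u)) ^ 4) \<partial>M) \<le> ennreal (Cg\<^sup>2)"
proof -
  have "AE \<omega> in M. nn_cond_exp M (sigma_gen M V (v 0))
      (\<lambda>\<eta>. ennreal ((op_norm (grad_matrix (gw (w 0 \<eta>)) u))\<^sup>2)) \<omega> \<le> ennreal Cg"
    using a1 unfolding scgd_assumption1_def by blast
  then show "(\<integral>\<^sup>+\<omega>. ennreal ((op_norm (grad_matrix (gw (w 0 \<omega>)) u))\<^sup>2) \<partial>M) \<le> ennreal Cg"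
    by (rule nn_integral_le_of_nn_cond_exp_v_le[rotated]) measurable
  have "AE \<omega> in M. nn_cond_exp M (sigma_gen M V (v 0))
      (\<lambda>\<eta>. ennreal ((op_norm (grad_matrix (gw (w 0 \<eta>)) u)) ^ 4)) \<omega> \<le> ennreal (Cg\<^sup>2)"
    using a2 unfolding scgd_assumption2_def by blast
  then show "(\<integral>\<^sup>+\<omega>. ennreal ((op_norm (grad_matrix (gw (w 0 \<omega>)) u)) ^ 4) \<partial>M) \<le> ennreal (Cg\<^sup>2)"
    by (rule nn_integral_le_of_nn_cond_exp_v_le[rotated]) measurable
qed

lemma gw_variance:
  "(\<integral>\<^sup>+\<omega>. ennreal ((norm (gw (w 0 \<omega>) u - g u))\<^sup>2) \<partial>M) \<le> ennreal Vg"
proof -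
  have "AE \<omega> in M. nn_cond_exp M (sigma_gen M V (v 0))
      (\<lambda>\<eta>. ennreal ((norm (gw (w 0 \<eta>) u - g u))\<^sup>2)) \<omega> \<le> ennreal Vg"
    using a1 unfolding scgd_assumption1_def by blast
  then show ?thesis
    by (rule nn_integral_le_of_nn_cond_exp_v_le[rotated]) measurable
qed

lemma grad_fv_lipschitz:
  "AE \<omega> in M. \<forall>t t'. norm (grad (fv (v 0 \<omega>)) t - grad (fv (v 0 \<omega>)) t') \<le> Lf * norm (t - t')"
  using a1 by (simp add: scgd_assumption1_def)

text \<open>Given \<open>w 0\<close>, both the operator norm and the argument
  \<open>P (w 0 \<omega>)\<close> are known, so the conditional moment of the gradient of
  \<open>fv\<close> splits off, although \<open>w 0\<close> and \<open>v 0\<close> may be dependent.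
  The argument may vary with \<open>w 0\<close> because \<open>y k\<close> depends on
  \<open>w k\<close>.\<close>

lemma grad_product_moment:
  assumes P [measurable]: "P \<in> borel_measurable W"
  shows "(\<integral>\<^sup>+\<omega>. ennreal (norm (grad_matrix (gw (w 0 \<omega>)) u *v grad (fv (v 0 \<omega>)) (P (w 0 \<omega>))) ^ 2) \<partial>M)
      \<le> ennreal (Cg * Cf)"
    and "(\<integral>\<^sup>+\<omega>. ennreal (norm (grad_matrix (gw (w 0 \<omega>)) u *v grad (fv (v 0 \<omega>)) (P (w 0 \<omega>))) ^ 4) \<partial>M)
      \<le> ennreal (Cg\<^sup>2 * Cf\<^sup>2)"
proof -
  have *: "(\<integral>\<^sup>+\<omega>. ennreal (norm (grad_matrix (gw (w 0 \<omega>)) u *v grad (fv (v 0 \<omega>)) (P (w 0 \<omega>))) ^ p) \<partial>M)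
      \<le> ennreal (Kg * Kf)"
    if le: "\<And>t. AE \<omega> in M. nn_cond_exp M (sigma_gen M W (w 0))
          (\<lambda>\<eta>. ennreal ((norm (grad (fv (v 0 \<eta>)) t)) ^ p)) \<omega> \<le> ennreal Kf"
      and Kg: "(\<integral>\<^sup>+\<omega>. ennreal ((op_norm (grad_matrix (gw (w 0 \<omega>)) u)) ^ p) \<partial>M) \<le> ennreal Kg"
      and "0 \<le> Kg" "0 \<le> Kf"
    for p Kg Kf
  proof -
    \<comment> \<open>The bound for fixed arguments extends to random ones only along continuous
      integrands; the almost sure Lipschitz condition supplies the continuity.\<close>
    have cont: "AE \<omega> in M. continuous_on UNIV (\<lambda>t. norm (grad (fv (v 0 \<omega>)) t) ^ p)"
      using grad_fv_lipschitz
    proof eventually_elim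
      case (elim \<omega>)
      then have "Lf-lipschitz_on UNIV (grad (fv (v 0 \<omega>)))"
        using constants_pos by (intro lipschitz_onI) (auto simp: dist_norm)
      then show ?case
        by (intro continuous_intros lipschitz_on_continuous_on)
    qed
    have "(\<integral>\<^sup>+\<omega>. ennreal (norm (grad_matrix (gw (w 0 \<omega>)) u *v grad (fv (v 0 \<omega>)) (P (w 0 \<omega>))) ^ p) \<partial>M)
      \<le> (\<integral>\<^sup>+\<omega>. ennreal (op_norm (grad_matrix (gw (w 0 \<omega>)) u) ^ p * norm (grad (fv (v 0 \<omega>)) (P (w 0 \<omega>))) ^ p) \<partial>M)"
      by (intro nn_integral_mono ennreal_leI)
        (simp add: norm_matrix_vector_mult_le power_mono flip: power_mult_distrib)
    also have "\<dots> \<le> ennreal Kf * (\<integral>\<^sup>+\<omega>. ennreal ((op_norm (grad_matrix (gw (w 0 \<omega>)) u)) ^ p) \<partial>M)"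
      by (rule nn_integral_le_of_nn_cond_exp_le_random[where
            A = "\<lambda>a. op_norm (grad_matrix (gw a) u) ^ p" and \<psi> = "\<lambda>b t. norm (grad (fv b) t) ^ p",
            OF _ v_measurable _ _ cont le])
        (auto simp: op_norm_nonneg)
    also have "\<dots> \<le> ennreal Kf * ennreal Kg"
      using Kg by (rule mult_left_mono) simp
    finally show ?thesis
      using that by (simp add: ennreal_mult' mult.commute)
  qed
  show "(\<integral>\<^sup>+\<omega>. ennreal (norm (grad_matrix (gw (w 0 \<omega>)) u *v grad (fv (v 0 \<omega>)) (P (w 0 \<omega>))) ^ 2) \<partial>M)
      \<le> ennreal (Cg * Cf)"
    using a1 constants_pos by (intro * op_norm_moment) (auto simp: scgd_assumption1_def)
  show "(\<integral>\<^sup>+\<omega>. ennreal (norm (grad_matrix (gw (w 0 \<omega>)) u *v grad (fv (v 0 \<omega>)) (P (w 0 \<omega>))) ^ 4) \<partial>M)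
      \<le> ennreal (Cg\<^sup>2 * Cf\<^sup>2)"
    using a2 constants_pos by (intro * op_norm_moment) (auto simp: scgd_assumption2_def)
qed

lemma grad_product_integrable:
  "integrable M (\<lambda>\<omega>. grad_matrix (gw (w 0 \<omega>)) u *v grad (fv (v 0 \<omega>)) (g u))"
proof (rule integrable_of_norm_power2)
  show "integrable M (\<lambda>\<omega>. (norm (grad_matrix (gw (w 0 \<omega>)) u *v grad (fv (v 0 \<omega>)) (g u)))\<^sup>2)"
    using grad_product_moment(1)[of "\<lambda>_. g u" u] constants_pos
    by (intro integrable_of_nn_integral_le[where K="Cg * Cf"]) auto
qed simp

text \<open>Integrating the conditional unbiasedness over \<open>v 0\<close> removes the
  conditioning. This is done by coordinates, as \<open>vec_cond_exp\<close> is defined by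
  coordinates.\<close>

lemma grad_product_integral:
  "(\<integral>\<omega>. grad_matrix (gw (w 0 \<omega>)) u *v grad (fv (v 0 \<omega>)) (g u) \<partial>M) = grad F u"
proof -
  let ?X = "\<lambda>\<omega>. grad_matrix (gw (w 0 \<omega>)) u *v grad (fv (v 0 \<omega>)) (g u)"
  interpret sub: finite_measure_subalgebra M "sigma_gen M V (v 0)"
    by (rule finite_measure_subalgebra_sigma_gen) simp
  have "F = (\<lambda>u. f (g u))"
    by (simp add: fun_eq_iff F_eq)
  then have ce: "AE \<omega> in M. vec_cond_exp M (sigma_gen M V (v 0)) ?X \<omega> = grad F u"
    using a1 by (simp add: scgd_assumption1_def)
  have "(\<integral>\<omega>. ?X \<omega> \<partial>M) $ i = grad F u $ i" for i
  proof -
    have int: "integrable M (\<lambda>\<omega>. ?X \<omega> $ i)"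
      using grad_product_integrable by (rule integrable_bounded_linear[OF bounded_linear_vec_nth])
    have "(\<integral>\<omega>. ?X \<omega> \<partial>M) $ i = (\<integral>\<omega>. ?X \<omega> $ i \<partial>M)"
      using grad_product_integrable by (rule integral_bounded_linear[OF bounded_linear_vec_nth, symmetric])
    also have "\<dots> = (\<integral>\<omega>. real_cond_exp M (sigma_gen M V (v 0)) (\<lambda>\<eta>. ?X \<eta> $ i) \<omega> \<partial>M)"
      by (rule sub.real_cond_exp_int(2)[OF int, symmetric])
    also have "\<dots> = (\<integral>\<omega>. grad F u $ i \<partial>M)"
      using ce by (intro integral_cong_AE) (auto simp: vec_cond_exp_def vec_eq_iff)
    finally show ?thesis
      by (simp add: prob_space)
  qed
  then show ?thesis
    by (simp add: vec_eq_iff)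
qed

text \<open>The gradient of \<open>F\<close> is the mean of a direction whose second moment is
  bounded uniformly in \<open>u\<close>. Hence \<open>grad F (x k \<omega>)\<close> is bounded
  without any moment bound on the iterates.\<close>

lemma norm_grad_F_le: "norm (grad F u) \<le> 1 + Cg * Cf"
proof -
  let ?X = "\<lambda>\<omega>. grad_matrix (gw (w 0 \<omega>)) u *v grad (fv (v 0 \<omega>)) (g u)"
  have sq: "integrable M (\<lambda>\<omega>. (norm (?X \<omega>))\<^sup>2)" "(\<integral>\<omega>. (norm (?X \<omega>))\<^sup>2 \<partial>M) \<le> Cg * Cf"
    using grad_product_moment(1)[of "\<lambda>_. g u" u] constants_pos
    by (intro integrable_of_nn_integral_le[where K="Cg * Cf"]; auto)+
  have "norm (grad F u) \<le> (\<integral>\<omega>. norm (?X \<omega>) \<partial>M)"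
    unfolding grad_product_integral[symmetric] by (rule integral_norm_bound)
  also have "\<dots> \<le> (\<integral>\<omega>. 1 + (norm (?X \<omega>))\<^sup>2 \<partial>M)"
    using sq grad_product_integrable by (intro integral_mono le_one_plus_power2) auto
  also have "\<dots> \<le> 1 + Cg * Cf"
    using sq by (simp add: prob_space)
  finally show ?thesis .
qed

section \<open>The iterates as a recursion driven by independent samples\<close>

lemma x_0: "\<omega> \<in> space M \<Longrightarrow> x 0 \<omega> = x0"
  and y_0: "\<omega> \<in> space M \<Longrightarrow> y 0 \<omega> = y0"
  and x_Suc: "\<omega> \<in> space M \<Longrightarrow> x (Suc k) \<omega> = x k \<omega>
      - \<alpha> k *\<^sub>R (grad_matrix (gw (w k \<omega>)) (x k \<omega>) *v grad (fv (v k \<omega>)) (y k \<omega>))"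
  and z_Suc: "\<omega> \<in> space M \<Longrightarrow> z (Suc k) \<omega> = - ((1 / \<beta> k - 1) *\<^sub>R x k \<omega>) + (1 / \<beta> k) *\<^sub>R x (Suc k) \<omega>"
  and y_Suc: "\<omega> \<in> space M \<Longrightarrow> y (Suc k) \<omega> = (1 - \<beta> k) *\<^sub>R y k \<omega> + \<beta> k *\<^sub>R gw (w (Suc k) \<omega>) (z (Suc k) \<omega>)"
  using iterates unfolding accelerated_scgd_def by blast+

abbreviation state_space :: "((real ^ 'n) \<times> (real ^ 'n) \<times> (real ^ 'm)) measure" where
  "state_space \<equiv> borel \<Otimes>\<^sub>M borel \<Otimes>\<^sub>M borel"

text \<open>\<^term>\<open>y k\<close> depends on the current sample \<^term>\<open>w k\<close>, so it cannot be part of a state that is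
  independent of \<^term>\<open>sample k\<close>; the state carries \<^term>\<open>y (k - 1)\<close> instead.\<close>

definition state :: "nat \<Rightarrow> 'a \<Rightarrow> (real ^ 'n) \<times> (real ^ 'n) \<times> (real ^ 'm)" where
  "state k \<omega> = (x k \<omega>, if k = 0 then 0 else z k \<omega>, if k = 0 then y0 else y (k - 1) \<omega>)"

text \<open>At \<open>k = 0\<close> the last two slots of the state hold placeholders, since
  \<open>z 0\<close> is unconstrained and no earlier \<open>y\<close> exists; they are ignored
  there.\<close>

definition y_of :: "nat \<Rightarrow> (real ^ 'n) \<times> (real ^ 'n) \<times> (real ^ 'm) \<Rightarrow> 'w \<Rightarrow> real ^ 'm" where
  "y_of k q a = (if k = 0 then y0
     else (1 - \<beta> (k - 1)) *\<^sub>R snd (snd q) + \<beta> (k - 1) *\<^sub>R gw a (fst (snd q)))"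

definition step :: "nat \<Rightarrow> (real ^ 'n) \<times> (real ^ 'n) \<times> (real ^ 'm) \<Rightarrow> 'w \<times> 'v \<Rightarrow> real ^ 'n" where
  "step k q s = fst q - \<alpha> k *\<^sub>R (grad_matrix (gw (fst s)) (fst q) *v grad (fv (snd s)) (y_of k q (fst s)))"

lemma y_of_measurable [measurable (raw)]:
  assumes [measurable]: "q \<in> measurable N state_space" "a \<in> measurable N W"
  shows "(\<lambda>\<omega>. y_of k (q \<omega>) (a \<omega>)) \<in> borel_measurable N"
  unfolding y_of_def by measurable

lemma step_measurable [measurable (raw)]:
  assumes [measurable]: "q \<in> measurable N state_space" "s \<in> measurable N (W \<Otimes>\<^sub>M V)"
  shows "(\<lambda>\<omega>. step k (q \<omega>) (s \<omega>)) \<in> borel_measurable N"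
  unfolding step_def by measurable

lemma y_eq_y_of: "\<omega> \<in> space M \<Longrightarrow> y k \<omega> = y_of k (state k \<omega>) (w k \<omega>)"
  by (cases k) (simp_all add: y_of_def state_def y_0 y_Suc)

lemma fst_state: "fst (state k \<omega>) = x k \<omega>"
  by (simp add: state_def)

lemma x_Suc_eq_step: "\<omega> \<in> space M \<Longrightarrow> x (Suc k) \<omega> = step k (state k \<omega>) (sample k \<omega>)"
  by (simp add: step_def sample_def x_Suc y_eq_y_of) (simp add: state_def)

text \<open>The next state depends on the present state and sample only: it stores the new
  \<open>x\<close>, the extrapolated point computed from both \<open>x\<close> values, and the
  present \<open>y\<close>, recovered through \<open>y_of\<close>.\<close>

lemma state_indep: "indep_pair state_space (state k) (W \<Otimes>\<^sub>M V) (sample k)"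
proof (rule indep_pair_recursion[OF sample_indep])
  let ?\<Phi> = "\<lambda>k p. (step k (fst p) (snd p),
      - ((1 / \<beta> k - 1) *\<^sub>R fst (fst p)) + (1 / \<beta> k) *\<^sub>R step k (fst p) (snd p),
      y_of k (fst p) (fst (snd p)))"
  show "?\<Phi> k \<in> measurable (state_space \<Otimes>\<^sub>M (W \<Otimes>\<^sub>M V)) state_space" for k
    by measurable
  show "state (Suc k) \<omega> = ?\<Phi> k (state k \<omega>, sample k \<omega>)" if "\<omega> \<in> space M" for k \<omega>
    using that
    by (simp add: state_def[of "Suc k"] z_Suc) (simp add: x_Suc_eq_step y_eq_y_of sample_def fst_state)
  show "state 0 \<omega> = (x0, 0, y0)" if "\<omega> \<in> space M" for \<omega>
    using that by (simp add: state_def x_0)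
qed (simp add: space_pair_measure)

lemma state_measurable [measurable]: "state k \<in> measurable M state_space"
  using state_indep[of k] by (simp add: indep_pair_def)

lemma x_measurable [measurable]: "x k \<in> borel_measurable M"
proof -
  have "(\<lambda>\<omega>. fst (state k \<omega>)) \<in> borel_measurable M"
    by measurable
  then show ?thesis
    by (simp add: state_def)
qed

text \<open>Stated for successors because \<open>z 0\<close> is arbitrary and may fail to be
  measurable.\<close>

lemma z_Suc_measurable [measurable]: "z (Suc k) \<in> borel_measurable M"
proof -
  have "(\<lambda>\<omega>. fst (snd (state (Suc k) \<omega>))) \<in> borel_measurable M"
    by measurable
  then show ?thesis
    by (simp add: state_def)
qed

lemma y_measurable [measurable]: "y k \<in> borel_measurable M"
proof -
  have "(\<lambda>\<omega>. snd (snd (state (Suc k) \<omega>))) \<in> borel_measurable M"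
    by measurable
  then show ?thesis
    by (simp add: state_def)
qed

lemmas nn_integral_state_sample =
  nn_integral_indep_copy[OF state_indep sample_measurable sample_distr]
lemmas integral_state_sample =
  integral_indep_copy[OF state_indep sample_measurable sample_distr]
lemmas AE_state_sample =
  AE_indep_copy[OF state_indep sample_measurable sample_distr]

section \<open>Moments of the directions and of the noise\<close>

definition dir :: "nat \<Rightarrow> 'a \<Rightarrow> real ^ 'n" where
  "dir k \<omega> = grad_matrix (gw (w k \<omega>)) (x k \<omega>) *v grad (fv (v k \<omega>)) (y k \<omega>)"

text \<open>The direction with the tracked value \<open>y k\<close> replaced by its target
  \<open>g (x k)\<close>; this is the one whose mean, with the past frozen, is the gradient of
  \<open>F\<close>.\<close>

definition dir_exact :: "nat \<Rightarrow> 'a \<Rightarrow> real ^ 'n" where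
  "dir_exact k \<omega> = grad_matrix (gw (w k \<omega>)) (x k \<omega>) *v grad (fv (v k \<omega>)) (g (x k \<omega>))"

definition err :: "nat \<Rightarrow> 'a \<Rightarrow> real ^ 'm" where
  "err k \<omega> = y k \<omega> - g (x k \<omega>)"

definition noise :: "nat \<Rightarrow> 'a \<Rightarrow> real ^ 'm" where
  "noise k \<omega> = gw (w (Suc k) \<omega>) (z (Suc k) \<omega>) - g (z (Suc k) \<omega>)"

text \<open>The error after step k if \<open>g\<close> were queried at \<open>z (Suc k)\<close>
  without noise; it is a function of \<open>state (Suc k)\<close>.\<close>

definition pred_err :: "nat \<Rightarrow> 'a \<Rightarrow> real ^ 'm" where
  "pred_err k \<omega> = (1 - \<beta> k) *\<^sub>R y k \<omega> + \<beta> k *\<^sub>R g (z (Suc k) \<omega>) - g (x (Suc k) \<omega>)"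

lemma dir_measurable [measurable]: "dir k \<in> borel_measurable M"
  and dir_exact_measurable [measurable]: "dir_exact k \<in> borel_measurable M"
  and err_measurable [measurable]: "err k \<in> borel_measurable M"
  and noise_measurable [measurable]: "noise k \<in> borel_measurable M"
  and pred_err_measurable [measurable]: "pred_err k \<in> borel_measurable M"
  unfolding dir_def[abs_def] dir_exact_def[abs_def] err_def[abs_def] noise_def[abs_def]
    pred_err_def[abs_def] by measurable

text \<open>Once the state is frozen, \<open>y k\<close> becomes a measurable function of the sample
  of \<open>w\<close> alone, which is the role of \<open>P\<close> in
  \<open>grad_product_moment\<close>.\<close>

lemma dir_moment:
  "integrable M (\<lambda>\<omega>. norm (dir k \<omega>) ^ 2)" "(\<integral>\<omega>. norm (dir k \<omega>) ^ 2 \<partial>M) \<le> Cg * Cf"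
  "integrable M (\<lambda>\<omega>. norm (dir k \<omega>) ^ 4)" "(\<integral>\<omega>. norm (dir k \<omega>) ^ 4 \<partial>M) \<le> Cg\<^sup>2 * Cf\<^sup>2"
proof -
  have *: "(\<integral>\<^sup>+\<omega>. ennreal (norm (dir k \<omega>) ^ p) \<partial>M) \<le> ennreal K"
    if K: "\<And>P u. P \<in> borel_measurable W \<Longrightarrow>
      (\<integral>\<^sup>+\<omega>. ennreal (norm (grad_matrix (gw (w 0 \<omega>)) u *v grad (fv (v 0 \<omega>)) (P (w 0 \<omega>))) ^ p) \<partial>M) \<le> ennreal K"
    for p K
  proof -
    let ?h = "\<lambda>r. ennreal (norm (grad_matrix (gw (fst (snd r))) (fst (fst r)) *v
        grad (fv (snd (snd r))) (y_of k (fst r) (fst (snd r)))) ^ p)"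
    have "(\<integral>\<^sup>+\<omega>. ennreal (norm (dir k \<omega>) ^ p) \<partial>M) = (\<integral>\<^sup>+\<omega>. ?h (state k \<omega>, sample k \<omega>) \<partial>M)"
      by (intro nn_integral_cong) (simp add: dir_def sample_def y_eq_y_of, simp add: state_def)
    also have "\<dots> = (\<integral>\<^sup>+\<omega>. \<integral>\<^sup>+\<omega>'. ?h (state k \<omega>, sample 0 \<omega>') \<partial>M \<partial>M)"
      by (rule nn_integral_state_sample) measurable
    also have "\<dots> \<le> (\<integral>\<^sup>+\<omega>. ennreal K \<partial>M)"
    proof (rule nn_integral_mono)
      fix \<omega> assume "\<omega> \<in> space M"
      have "state k \<omega> \<in> space state_space"
        by (simp add: space_pair_measure)
      then have "(\<lambda>a. y_of k (state k \<omega>) a) \<in> borel_measurable W"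
        by measurable
      from K[OF this] show "(\<integral>\<^sup>+\<omega>'. ?h (state k \<omega>, sample 0 \<omega>') \<partial>M) \<le> ennreal K"
        by (simp add: sample_def)
    qed
    also have "\<dots> = ennreal K"
      by (simp add: emeasure_space_1)
    finally show ?thesis .
  qed
  show "integrable M (\<lambda>\<omega>. norm (dir k \<omega>) ^ 2)" "(\<integral>\<omega>. norm (dir k \<omega>) ^ 2 \<partial>M) \<le> Cg * Cf"
    using *[OF grad_product_moment(1)] constants_pos
    by (intro integrable_of_nn_integral_le[where K="Cg * Cf"]; simp)+
  show "integrable M (\<lambda>\<omega>. norm (dir k \<omega>) ^ 4)" "(\<integral>\<omega>. norm (dir k \<omega>) ^ 4 \<partial>M) \<le> Cg\<^sup>2 * Cf\<^sup>2"
    using *[OF grad_product_moment(2)] constants_pos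
    by (intro integrable_of_nn_integral_le[where K="Cg\<^sup>2 * Cf\<^sup>2"]; simp)+
qed

lemma dir_exact_moment:
  "integrable M (\<lambda>\<omega>. norm (dir_exact k \<omega>) ^ 2)"
proof -
  let ?h = "\<lambda>r. ennreal (norm (grad_matrix (gw (fst (snd r))) (fst (fst r)) *v
      grad (fv (snd (snd r))) (g (fst (fst r)))) ^ 2)"
  have "(\<integral>\<^sup>+\<omega>. ennreal (norm (dir_exact k \<omega>) ^ 2) \<partial>M) = (\<integral>\<^sup>+\<omega>. ?h (state k \<omega>, sample k \<omega>) \<partial>M)"
    by (intro nn_integral_cong) (simp add: dir_exact_def sample_def state_def)
  also have "\<dots> = (\<integral>\<^sup>+\<omega>. \<integral>\<^sup>+\<omega>'. ?h (state k \<omega>, sample 0 \<omega>') \<partial>M \<partial>M)"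
    by (rule nn_integral_state_sample) measurable
  also have "\<dots> \<le> (\<integral>\<^sup>+\<omega>. ennreal (Cg * Cf) \<partial>M)"
    using grad_product_moment(1)[of "\<lambda>_. g (x k _)"]
    by (intro nn_integral_mono) (simp add: sample_def state_def)
  also have "\<dots> = ennreal (Cg * Cf)"
    by (simp add: emeasure_space_1)
  finally show ?thesis
    using constants_pos by (intro integrable_of_nn_integral_le[where K="Cg * Cf"]) auto
qed

text \<open>\<open>z (Suc k)\<close> is stored in \<open>state (Suc k)\<close>, which is independent
  of \<open>sample (Suc k)\<close>, so the variance bound at a fixed argument applies.\<close>

lemma noise_moment:
  "integrable M (\<lambda>\<omega>. norm (noise k \<omega>) ^ 2)" "(\<integral>\<omega>. norm (noise k \<omega>) ^ 2 \<partial>M) \<le> Vg"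
proof -
  let ?h = "\<lambda>r. ennreal (norm (gw (fst (snd r)) (fst (snd (fst r))) - g (fst (snd (fst r)))) ^ 2)"
  have "(\<integral>\<^sup>+\<omega>. ennreal (norm (noise k \<omega>) ^ 2) \<partial>M) = (\<integral>\<^sup>+\<omega>. ?h (state (Suc k) \<omega>, sample (Suc k) \<omega>) \<partial>M)"
    by (intro nn_integral_cong) (simp add: noise_def sample_def state_def)
  also have "\<dots> = (\<integral>\<^sup>+\<omega>. \<integral>\<^sup>+\<omega>'. ?h (state (Suc k) \<omega>, sample 0 \<omega>') \<partial>M \<partial>M)"
    by (rule nn_integral_state_sample) measurable
  also have "\<dots> \<le> (\<integral>\<^sup>+\<omega>. ennreal Vg \<partial>M)"
    using gw_variance by (intro nn_integral_mono) (simp add: sample_def state_def)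
  also have "\<dots> = ennreal Vg"
    by (simp add: emeasure_space_1)
  finally have "(\<integral>\<^sup>+\<omega>. ennreal (norm (noise k \<omega>) ^ 2) \<partial>M) \<le> ennreal Vg" .
  then show "integrable M (\<lambda>\<omega>. norm (noise k \<omega>) ^ 2)" "(\<integral>\<omega>. norm (noise k \<omega>) ^ 2 \<partial>M) \<le> Vg"
    using constants_pos by (intro integrable_of_nn_integral_le[where K=Vg]; simp)+
qed

section \<open>The recursion for the tracking error\<close>

lemma err_Suc:
  assumes "\<omega> \<in> space M"
  shows "err (Suc k) \<omega> = pred_err k \<omega> + \<beta> k *\<^sub>R noise k \<omega>"
  using assms by (simp add: err_def pred_err_def noise_def y_Suc algebra_simps)

text \<open>With \<open>state (Suc k)\<close> frozen, \<open>pred_err k\<close> and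
  \<open>z (Suc k)\<close> are constants, and \<open>gw (w 0 \<omega>)\<close> has mean
  \<open>g\<close> at every fixed point, so each inner integral is zero.\<close>

lemma pred_err_noise_orthogonal:
  assumes "integrable M (\<lambda>\<omega>. (norm (pred_err k \<omega>))\<^sup>2)"
  shows "(\<integral>\<omega>. inner (pred_err k \<omega>) (noise k \<omega>) \<partial>M) = 0"
proof -
  let ?p = "\<lambda>q. (1 - \<beta> k) *\<^sub>R snd (snd q) + \<beta> k *\<^sub>R g (fst (snd q)) - g (fst q)"
  let ?h = "\<lambda>r. inner (?p (fst r)) (gw (fst (snd r)) (fst (snd (fst r))) - g (fst (snd (fst r))))"
  have eq: "(\<lambda>\<omega>. inner (pred_err k \<omega>) (noise k \<omega>)) = (\<lambda>\<omega>. ?h (state (Suc k) \<omega>, sample (Suc k) \<omega>))"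
    by (simp add: fun_eq_iff pred_err_def noise_def state_def sample_def)
  have "integrable M (\<lambda>\<omega>. inner (pred_err k \<omega>) (noise k \<omega>))"
    using assms noise_moment(1)[of k] by (intro integrable_inner_of_norm_power2) auto
  then have "(\<integral>\<omega>. inner (pred_err k \<omega>) (noise k \<omega>) \<partial>M)
      = (\<integral>\<omega>. \<integral>\<omega>'. ?h (state (Suc k) \<omega>, sample 0 \<omega>') \<partial>M \<partial>M)"
    unfolding eq by (intro integral_state_sample) measurable
  also have "\<dots> = 0"
  proof -
    have "(\<integral>\<omega>'. inner c (gw (w 0 \<omega>') u - g u) \<partial>M) = 0" for c u
      using gw_integrable[of u] gw_integral[of u] by (simp add: prob_space)
    then show ?thesis
      by (simp add: sample_def)
  qed
  finally show ?thesis .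
qed

text \<open>As \<^term>\<open>x (Suc k)\<close> is the convex combination of \<^term>\<open>x k\<close> and \<^term>\<open>z (Suc k)\<close> with
  weight \<^term>\<open>\<beta> k\<close>, the first-order terms cancel and only a quadratic remainder is left.\<close>

lemma pred_err_bound:
  "\<exists>L\<ge>0. \<forall>k. \<forall>\<omega>\<in>space M. (norm (pred_err k \<omega>))\<^sup>2
      \<le> (1 - \<beta> k) * (norm (err k \<omega>))\<^sup>2 + L * (\<alpha> k ^ 4 / \<beta> k ^ 3) * norm (dir k \<omega>) ^ 4"
proof -
  obtain Lg where Lg: "0 < Lg" "\<And>u u'. op_norm (grad_matrix g u - grad_matrix g u') \<le> Lg * norm (u - u')"
    using a2 by (auto simp: scgd_assumption2_def)
  define m where "m = real CARD('m)"
  have main: "(norm (pred_err k \<omega>))\<^sup>2 \<le> (1 - \<beta> k) * (norm (err k \<omega>))\<^sup>2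
      + (m * Lg)\<^sup>2 * (\<alpha> k ^ 4 / \<beta> k ^ 3) * norm (dir k \<omega>) ^ 4" if \<omega>: "\<omega> \<in> space M" for k \<omega>
  proof -
    define b where "b = \<beta> k"
    have b: "0 < b" "b \<le> 1"
      using \<beta>_pos \<beta>_le_1 by (auto simp: b_def)
    define p where "p = x k \<omega>"
    define q where "q = x (Suc k) \<omega>"
    define u where "u = z (Suc k) \<omega>"
    define d where "d = norm (p - q)"
    define R where "R = (1 - b) *\<^sub>R g p + b *\<^sub>R g u - g q"
    have pu: "u - q = ((1 - b) / b) *\<^sub>R (q - p)"
      using b z_Suc[OF \<omega>, of k]
      by (simp add: p_def q_def u_def b_def[symmetric] algebra_simps diff_divide_distrib)
    have nR: "norm R \<le> m * (Lg * ((1 - b) / b * d\<^sup>2))"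
    proof -
      have "\<bar>R $ j\<bar> \<le> Lg * ((1 - b) / b * d\<^sup>2)" for j
      proof -
        \<comment> \<open>Second-order remainder of the j-th component of \<open>g\<close>, expanded
          at the new iterate \<open>q\<close>. That is the point where the linear terms at
          \<open>p\<close> and \<open>u\<close> cancel.\<close>
        define \<delta> where "\<delta> s = g s $ j - g q $ j - inner (grad (\<lambda>u. g u $ j) q) (s - q)" for s
        have \<delta>: "\<bar>\<delta> s\<bar> \<le> Lg * (norm (s - q))\<^sup>2" for s
          unfolding \<delta>_def
          using Lg by (intro grad_lipschitz_remainder_le differentiable_vec_nth g_differentiable)
            (auto intro: order_trans[OF norm_column_grad_le_op_norm])
        have "b *\<^sub>R (u - q) = (1 - b) *\<^sub>R (q - p)"
          using b by (simp add: pu)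
        then have "(1 - b) *\<^sub>R (p - q) + b *\<^sub>R (u - q) = 0"
          by (simp add: algebra_simps)
        then have "inner (grad (\<lambda>u. g u $ j) q) ((1 - b) *\<^sub>R (p - q) + b *\<^sub>R (u - q)) = 0"
          by simp
        then have "R $ j = (1 - b) * \<delta> p + b * \<delta> u"
          by (simp add: R_def \<delta>_def inner_add_right algebra_simps)
        also have "\<bar>\<dots>\<bar> \<le> (1 - b) * \<bar>\<delta> p\<bar> + b * \<bar>\<delta> u\<bar>"
          using b by (intro order_trans[OF abs_triangle_ineq]) (simp add: abs_mult)
        also have "\<dots> \<le> (1 - b) * (Lg * (norm (p - q))\<^sup>2) + b * (Lg * (norm (u - q))\<^sup>2)"
          using b by (intro add_mono mult_left_mono \<delta>) auto
        also have "norm (u - q) = (1 - b) / b * d"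
          using b by (simp add: pu d_def norm_minus_commute)
        also have "(1 - b) * (Lg * (norm (p - q))\<^sup>2) + b * (Lg * ((1 - b) / b * d)\<^sup>2) = Lg * ((1 - b) / b * d\<^sup>2)"
          using b by (simp add: d_def field_simps power2_eq_square)
        finally show ?thesis .
      qed
      \<comment> \<open>The Euclidean norm is bounded by the sum of the coordinates' absolute
        values, whence the factor \<open>m\<close>.\<close>
      then have "(\<Sum>j\<in>UNIV. \<bar>R $ j\<bar>) \<le> m * (Lg * ((1 - b) / b * d\<^sup>2))"
        unfolding m_def by (intro sum_bounded_above)
      then show ?thesis
        using norm_le_l1_cart[of R] by linarith
    qed
    have d: "d = \<alpha> k * norm (dir k \<omega>)"
      using \<alpha>_pos[of k] x_Suc[OF \<omega>, of k] by (simp add: d_def p_def q_def dir_def)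
    have "norm R \<le> m * (Lg * (1 / b * d\<^sup>2))"
      using b Lg by (intro order_trans[OF nR] mult_left_mono mult_right_mono divide_right_mono)
        (auto simp: m_def)
    then have nR': "norm R \<le> m * Lg * d\<^sup>2 / b"
      by simp
    have "pred_err k \<omega> = (1 - b) *\<^sub>R err k \<omega> + R"
      by (simp add: pred_err_def err_def R_def p_def q_def u_def b_def algebra_simps)
    \<comment> \<open>Writing \<open>R\<close> with weight \<open>b\<close> gives a convex
      combination, so that the factor of |err|^2 stays \<open>1 - b\<close>. The price is |R|^2 / b,
      which raises the power of \<open>\<beta> k\<close> in the denominator from 2 to 3.\<close>
    also have "\<dots> = (1 - b) *\<^sub>R err k \<omega> + b *\<^sub>R ((1 / b) *\<^sub>R R)"
      using b by simp
    finally have "(norm (pred_err k \<omega>))\<^sup>2 \<le> (1 - b) * (norm (err k \<omega>))\<^sup>2 + b * (norm ((1 / b) *\<^sub>R R))\<^sup>2"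
      using b norm_convex_comb_power2_le[of b "err k \<omega>" "(1 / b) *\<^sub>R R"] by simp
    also have "b * (norm ((1 / b) *\<^sub>R R))\<^sup>2 = (norm R)\<^sup>2 / b"
      using b by (simp add: power2_eq_square field_simps)
    also have "\<dots> \<le> (m * Lg * d\<^sup>2 / b)\<^sup>2 / b"
      using nR' b by (intro divide_right_mono power_mono) auto
    also have "\<dots> = (m * Lg)\<^sup>2 * (\<alpha> k ^ 4 / b ^ 3) * norm (dir k \<omega>) ^ 4"
      by (simp add: d power_mult_distrib power_divide power2_eq_square power3_eq_cube power4_eq_xxxx)
    finally show ?thesis
      by (simp add: b_def)
  qed
  then show ?thesis
    by (intro exI[of _ "(m * Lg)\<^sup>2"]) simp
qed

lemma err_moment: "integrable M (\<lambda>\<omega>. (norm (err k \<omega>))\<^sup>2)"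
  and err_recursion: "\<exists>C\<ge>0. \<forall>k. (\<integral>\<omega>. (norm (err (Suc k) \<omega>))\<^sup>2 \<partial>M)
      \<le> (1 - \<beta> k) * (\<integral>\<omega>. (norm (err k \<omega>))\<^sup>2 \<partial>M) + C * (\<alpha> k ^ 4 / \<beta> k ^ 3) + (\<beta> k)\<^sup>2 * Vg"
proof -
  obtain L where L: "0 \<le> L" and le: "\<And>k \<omega>. \<omega> \<in> space M \<Longrightarrow> (norm (pred_err k \<omega>))\<^sup>2
      \<le> (1 - \<beta> k) * (norm (err k \<omega>))\<^sup>2 + L * (\<alpha> k ^ 4 / \<beta> k ^ 3) * norm (dir k \<omega>) ^ 4"
    using pred_err_bound by auto
  define c where "c k = L * (\<alpha> k ^ 4 / \<beta> k ^ 3)" for k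
  have c: "0 \<le> c k" for k
    using L \<alpha>_pos[of k] \<beta>_pos[of k] by (simp add: c_def)
  note le = le[folded c_def]
  have expand: "(norm (err (Suc k) \<omega>))\<^sup>2
      = (norm (pred_err k \<omega>))\<^sup>2 + 2 * \<beta> k * inner (pred_err k \<omega>) (noise k \<omega>) + (\<beta> k)\<^sup>2 * (norm (noise k \<omega>))\<^sup>2"
    if "\<omega> \<in> space M" for k \<omega>
    unfolding err_Suc[OF that] power2_norm_eq_inner
    by (simp add: inner_simps inner_commute algebra_simps power2_eq_square)
  have pred: "integrable M (\<lambda>\<omega>. (norm (pred_err k \<omega>))\<^sup>2)"
    if "integrable M (\<lambda>\<omega>. (norm (err k \<omega>))\<^sup>2)" for k
  proof (rule Bochner_Integration.integrable_bound)
    show "integrable M (\<lambda>\<omega>. (1 - \<beta> k) * (norm (err k \<omega>))\<^sup>2 + c k * norm (dir k \<omega>) ^ 4)"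
      using that dir_moment(3)[of k] by simp
    show "AE \<omega> in M. norm ((norm (pred_err k \<omega>))\<^sup>2) \<le>
        norm ((1 - \<beta> k) * (norm (err k \<omega>))\<^sup>2 + c k * norm (dir k \<omega>) ^ 4)"
      using le by (intro AE_I2) (auto intro: order_trans[OF _ abs_ge_self])
  qed simp
  have inner_int: "integrable M (\<lambda>\<omega>. inner (pred_err k \<omega>) (noise k \<omega>))"
    if "integrable M (\<lambda>\<omega>. (norm (err k \<omega>))\<^sup>2)" for k
    using pred[OF that] noise_moment(1)[of k] by (intro integrable_inner_of_norm_power2) auto
  \<comment> \<open>Splitting the integral below presupposes square integrability of
    \<open>err k\<close>; it propagates from k to k+1 through the pointwise bound on
    \<open>pred_err\<close> and the fourth moment of \<open>dir\<close>.\<close>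
  have int: "integrable M (\<lambda>\<omega>. (norm (err k \<omega>))\<^sup>2)" for k
  proof (induction k)
    case 0
    have "integrable M (\<lambda>\<omega>. (norm (err 0 \<omega>))\<^sup>2) \<longleftrightarrow> integrable M (\<lambda>\<omega>. (norm (y0 - g x0))\<^sup>2)"
      by (intro Bochner_Integration.integrable_cong) (auto simp: err_def x_0 y_0)
    then show ?case
      by simp
  next
    case (Suc k)
    have "integrable M (\<lambda>\<omega>. (norm (err (Suc k) \<omega>))\<^sup>2) \<longleftrightarrow> integrable M (\<lambda>\<omega>.
        (norm (pred_err k \<omega>))\<^sup>2 + 2 * \<beta> k * inner (pred_err k \<omega>) (noise k \<omega>) + (\<beta> k)\<^sup>2 * (norm (noise k \<omega>))\<^sup>2)"
      by (intro Bochner_Integration.integrable_cong) (auto simp: expand)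
    then show ?case
      using Suc pred inner_int noise_moment(1)[of k] by simp
  qed
  show "integrable M (\<lambda>\<omega>. (norm (err k \<omega>))\<^sup>2)"
    by (rule int)
  have "(\<integral>\<omega>. (norm (err (Suc k) \<omega>))\<^sup>2 \<partial>M)
      \<le> (1 - \<beta> k) * (\<integral>\<omega>. (norm (err k \<omega>))\<^sup>2 \<partial>M) + L * (Cg\<^sup>2 * Cf\<^sup>2) * (\<alpha> k ^ 4 / \<beta> k ^ 3) + (\<beta> k)\<^sup>2 * Vg" for k
  proof -
    have "(\<integral>\<omega>. (norm (err (Suc k) \<omega>))\<^sup>2 \<partial>M) = (\<integral>\<omega>. (norm (pred_err k \<omega>))\<^sup>2
        + 2 * \<beta> k * inner (pred_err k \<omega>) (noise k \<omega>) + (\<beta> k)\<^sup>2 * (norm (noise k \<omega>))\<^sup>2 \<partial>M)"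
      by (intro Bochner_Integration.integral_cong) (auto simp: expand)
    also have "\<dots> = (\<integral>\<omega>. (norm (pred_err k \<omega>))\<^sup>2 \<partial>M)
        + 2 * \<beta> k * (\<integral>\<omega>. inner (pred_err k \<omega>) (noise k \<omega>) \<partial>M) + (\<beta> k)\<^sup>2 * (\<integral>\<omega>. (norm (noise k \<omega>))\<^sup>2 \<partial>M)"
      using pred[OF int] inner_int[OF int] noise_moment(1)[of k] by simp
    also have "\<dots> = (\<integral>\<omega>. (norm (pred_err k \<omega>))\<^sup>2 \<partial>M) + (\<beta> k)\<^sup>2 * (\<integral>\<omega>. (norm (noise k \<omega>))\<^sup>2 \<partial>M)"
      by (simp add: pred_err_noise_orthogonal pred int)
    also have "(\<integral>\<omega>. (norm (pred_err k \<omega>))\<^sup>2 \<partial>M) \<le> (\<integral>\<omega>. (1 - \<beta> k) * (norm (err k \<omega>))\<^sup>2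
        + c k * norm (dir k \<omega>) ^ 4 \<partial>M)"
      using int dir_moment(3)[of k] by (intro integral_mono le pred) auto
    also have "\<dots> = (1 - \<beta> k) * (\<integral>\<omega>. (norm (err k \<omega>))\<^sup>2 \<partial>M)
        + c k * (\<integral>\<omega>. norm (dir k \<omega>) ^ 4 \<partial>M)"
      using int dir_moment(3)[of k] by simp
    also have "c k * (\<integral>\<omega>. norm (dir k \<omega>) ^ 4 \<partial>M)
        \<le> c k * (Cg\<^sup>2 * Cf\<^sup>2)"
      by (intro mult_left_mono dir_moment c)
    also have "(\<beta> k)\<^sup>2 * (\<integral>\<omega>. (norm (noise k \<omega>))\<^sup>2 \<partial>M) \<le> (\<beta> k)\<^sup>2 * Vg"
      by (intro mult_left_mono noise_moment) simp
    finally show ?thesis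
      by (simp add: c_def mult_ac)
  qed
  then show "\<exists>C\<ge>0. \<forall>k. (\<integral>\<omega>. (norm (err (Suc k) \<omega>))\<^sup>2 \<partial>M)
      \<le> (1 - \<beta> k) * (\<integral>\<omega>. (norm (err k \<omega>))\<^sup>2 \<partial>M) + C * (\<alpha> k ^ 4 / \<beta> k ^ 3) + (\<beta> k)\<^sup>2 * Vg"
    using L by (intro exI[of _ "L * (Cg\<^sup>2 * Cf\<^sup>2)"]) auto
qed

section \<open>The descent inequality\<close>

lemma grad_F_moment: "integrable M (\<lambda>\<omega>. (norm (grad F (x k \<omega>)))\<^sup>2)"
proof (rule Bochner_Integration.integrable_bound)
  show "integrable M (\<lambda>\<omega>. (1 + Cg * Cf)\<^sup>2)"
    by simp
  show "AE \<omega> in M. norm ((norm (grad F (x k \<omega>)))\<^sup>2) \<le> norm ((1 + Cg * Cf)\<^sup>2)"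
    using norm_grad_F_le by (intro AE_I2) (simp add: power_mono)
qed simp

lemma inner_grad_F_dir_exact:
  "(\<integral>\<omega>. inner (grad F (x k \<omega>)) (dir_exact k \<omega>) \<partial>M) = (\<integral>\<omega>. (norm (grad F (x k \<omega>)))\<^sup>2 \<partial>M)"
proof -
  let ?h = "\<lambda>r. inner (grad F (fst (fst r))) (grad_matrix (gw (fst (snd r))) (fst (fst r)) *v
      grad (fv (snd (snd r))) (g (fst (fst r))))"
  have eq: "(\<lambda>\<omega>. inner (grad F (x k \<omega>)) (dir_exact k \<omega>)) = (\<lambda>\<omega>. ?h (state k \<omega>, sample k \<omega>))"
    by (simp add: fun_eq_iff dir_exact_def fst_state sample_def)
  have "integrable M (\<lambda>\<omega>. inner (grad F (x k \<omega>)) (dir_exact k \<omega>))"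
    using grad_F_moment[of k] dir_exact_moment[of k] by (intro integrable_inner_of_norm_power2) auto
  then have "(\<integral>\<omega>. inner (grad F (x k \<omega>)) (dir_exact k \<omega>) \<partial>M)
      = (\<integral>\<omega>. \<integral>\<omega>'. ?h (state k \<omega>, sample 0 \<omega>') \<partial>M \<partial>M)"
    unfolding eq by (intro integral_state_sample) measurable
  also have "\<dots> = (\<integral>\<omega>. (norm (grad F (x k \<omega>)))\<^sup>2 \<partial>M)"
    using grad_product_integrable
    by (simp add: sample_def fst_state grad_product_integral power2_norm_eq_inner)
  finally show ?thesis .
qed

text \<open>With \<open>x k\<close> frozen, the gradient of \<open>F\<close> is a constant factor
  and the matrix contributes at most \<open>Cg\<close>. So the bound is a multiple of E|grad
  F(x(k))|^2 and can be absorbed.\<close>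

lemma op_norm_grad_F_moment:
  "integrable M (\<lambda>\<omega>. (norm (grad F (x k \<omega>)) * op_norm (grad_matrix (gw (w k \<omega>)) (x k \<omega>)))\<^sup>2)"
  "(\<integral>\<omega>. (norm (grad F (x k \<omega>)) * op_norm (grad_matrix (gw (w k \<omega>)) (x k \<omega>)))\<^sup>2 \<partial>M)
    \<le> Cg * (\<integral>\<omega>. (norm (grad F (x k \<omega>)))\<^sup>2 \<partial>M)"
proof -
  let ?h = "\<lambda>r. ennreal ((norm (grad F (fst (fst r))))\<^sup>2)
      * ennreal ((op_norm (grad_matrix (gw (fst (snd r))) (fst (fst r))))\<^sup>2)"
  have "(\<integral>\<^sup>+\<omega>. ennreal ((norm (grad F (x k \<omega>)) * op_norm (grad_matrix (gw (w k \<omega>)) (x k \<omega>)))\<^sup>2) \<partial>M)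
      = (\<integral>\<^sup>+\<omega>. ?h (state k \<omega>, sample k \<omega>) \<partial>M)"
    by (intro nn_integral_cong) (simp add: fst_state sample_def power_mult_distrib ennreal_mult)
  also have "\<dots> = (\<integral>\<^sup>+\<omega>. \<integral>\<^sup>+\<omega>'. ?h (state k \<omega>, sample 0 \<omega>') \<partial>M \<partial>M)"
    by (rule nn_integral_state_sample) measurable
  also have "\<dots> \<le> (\<integral>\<^sup>+\<omega>. ennreal ((norm (grad F (x k \<omega>)))\<^sup>2) * ennreal Cg \<partial>M)"
    by (intro nn_integral_mono)
      (simp add: sample_def fst_state nn_integral_cmult mult_left_mono op_norm_moment(1))
  also have "\<dots> = ennreal (\<integral>\<omega>. (norm (grad F (x k \<omega>)))\<^sup>2 \<partial>M) * ennreal Cg"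
    by (simp add: nn_integral_multc nn_integral_eq_integral grad_F_moment)
  also have "\<dots> = ennreal (Cg * (\<integral>\<omega>. (norm (grad F (x k \<omega>)))\<^sup>2 \<partial>M))"
    using constants_pos by (simp add: ennreal_mult mult.commute)
  finally have *: "(\<integral>\<^sup>+\<omega>. ennreal ((norm (grad F (x k \<omega>)) * op_norm (grad_matrix (gw (w k \<omega>)) (x k \<omega>)))\<^sup>2) \<partial>M)
      \<le> ennreal (Cg * (\<integral>\<omega>. (norm (grad F (x k \<omega>)))\<^sup>2 \<partial>M))" .
  show "integrable M (\<lambda>\<omega>. (norm (grad F (x k \<omega>)) * op_norm (grad_matrix (gw (w k \<omega>)) (x k \<omega>)))\<^sup>2)"
    "(\<integral>\<omega>. (norm (grad F (x k \<omega>)) * op_norm (grad_matrix (gw (w k \<omega>)) (x k \<omega>)))\<^sup>2 \<partial>M)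
      \<le> Cg * (\<integral>\<omega>. (norm (grad F (x k \<omega>)))\<^sup>2 \<partial>M)"
    using constants_pos by (intro integrable_of_nn_integral_le[OF _ _ *]; simp)+
qed

text \<open>The Lipschitz condition is assumed outside a null set for \<open>v 0\<close>; freezing
  carries it over to \<open>v k\<close> at the random arguments \<open>y k\<close> and
  \<open>g (x k)\<close>.\<close>

lemma dir_diff_bound:
  "AE \<omega> in M. norm (grad (fv (v k \<omega>)) (y k \<omega>) - grad (fv (v k \<omega>)) (g (x k \<omega>))) \<le> Lf * norm (err k \<omega>)"
proof -
  let ?P = "\<lambda>r. norm (grad (fv (snd (snd r))) (y_of k (fst r) (fst (snd r))) - grad (fv (snd (snd r))) (g (fst (fst r))))
      \<le> Lf * norm (y_of k (fst r) (fst (snd r)) - g (fst (fst r)))"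
  have "AE \<omega> in M. ?P (state k \<omega>, sample k \<omega>)"
  proof (rule AE_state_sample)
    show "AE \<omega>' in M. ?P (state k \<omega>, sample 0 \<omega>')" for \<omega>
      using grad_fv_lipschitz by eventually_elim (simp add: sample_def)
  qed measurable
  then show ?thesis
    using AE_space by eventually_elim (simp add: sample_def y_eq_y_of[symmetric] fst_state err_def)
qed

lemma inner_grad_F_dir:
  "integrable M (\<lambda>\<omega>. inner (grad F (x k \<omega>)) (dir k \<omega>))"
  "(\<integral>\<omega>. (norm (grad F (x k \<omega>)))\<^sup>2 \<partial>M) / 2 - Cg * Lf\<^sup>2 / 2 * (\<integral>\<omega>. (norm (err k \<omega>))\<^sup>2 \<partial>M)
    \<le> (\<integral>\<omega>. inner (grad F (x k \<omega>)) (dir k \<omega>) \<partial>M)"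
proof -
  let ?G = "\<lambda>\<omega>. (norm (grad F (x k \<omega>)) * op_norm (grad_matrix (gw (w k \<omega>)) (x k \<omega>)))\<^sup>2"
  have int: "integrable M (\<lambda>\<omega>. inner (grad F (x k \<omega>)) (dir k \<omega>))"
      "integrable M (\<lambda>\<omega>. inner (grad F (x k \<omega>)) (dir_exact k \<omega>))"
    using grad_F_moment[of k] dir_exact_moment[of k] dir_moment(1)[of k]
    by (auto intro!: integrable_inner_of_norm_power2)
  then show "integrable M (\<lambda>\<omega>. inner (grad F (x k \<omega>)) (dir k \<omega>))"
    by simp
  have int_err: "integrable M (\<lambda>\<omega>. (norm (err k \<omega>))\<^sup>2)"
    by (rule err_moment)
  have "AE \<omega> in M. inner (grad F (x k \<omega>)) (dir_exact k \<omega>) - inner (grad F (x k \<omega>)) (dir k \<omega>)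
      \<le> ?G \<omega> / (2 * Cg) + Cg * Lf\<^sup>2 / 2 * (norm (err k \<omega>))\<^sup>2"
    using dir_diff_bound[of k]
  proof eventually_elim
    case (elim \<omega>)
    define A where "A = norm (grad F (x k \<omega>)) * op_norm (grad_matrix (gw (w k \<omega>)) (x k \<omega>))"
    define B where "B = Lf * norm (err k \<omega>)"
    let ?D = "grad (fv (v k \<omega>)) (y k \<omega>) - grad (fv (v k \<omega>)) (g (x k \<omega>))"
    have "inner (grad F (x k \<omega>)) (dir_exact k \<omega>) - inner (grad F (x k \<omega>)) (dir k \<omega>)
        = - inner (grad F (x k \<omega>)) (grad_matrix (gw (w k \<omega>)) (x k \<omega>) *v ?D)"
      by (simp add: dir_def dir_exact_def matrix_vector_mult_diff_distrib inner_diff_right)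
    also have "\<dots> \<le> norm (grad F (x k \<omega>)) * norm (grad_matrix (gw (w k \<omega>)) (x k \<omega>) *v ?D)"
      using Cauchy_Schwarz_ineq2[of "grad F (x k \<omega>)" "grad_matrix (gw (w k \<omega>)) (x k \<omega>) *v ?D"] by linarith
    also have "\<dots> \<le> norm (grad F (x k \<omega>)) * (op_norm (grad_matrix (gw (w k \<omega>)) (x k \<omega>)) * B)"
      using elim by (intro mult_left_mono order_trans[OF norm_matrix_vector_mult_le])
        (auto simp: B_def op_norm_nonneg)
    also have "\<dots> = A * B"
      by (simp add: A_def)
    \<comment> \<open>Nonnegativity of (A - Cg B)^2. The weight \<open>Cg\<close> is chosen so that
      A^2 / (2 Cg) integrates to at most half of E|grad F(x(k))|^2.\<close>
    also have "\<dots> \<le> A\<^sup>2 / (2 * Cg) + Cg * B\<^sup>2 / 2"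
      using constants_pos zero_le_power2[of "A - Cg * B"]
      by (simp add: power2_diff field_simps power2_eq_square)
    finally show ?case
      by (simp add: A_def B_def power_mult_distrib mult_ac)
  qed
  then have "(\<integral>\<omega>. inner (grad F (x k \<omega>)) (dir_exact k \<omega>) - inner (grad F (x k \<omega>)) (dir k \<omega>) \<partial>M)
      \<le> (\<integral>\<omega>. ?G \<omega> / (2 * Cg) + Cg * Lf\<^sup>2 / 2 * (norm (err k \<omega>))\<^sup>2 \<partial>M)"
    using int int_err op_norm_grad_F_moment(1)[of k]
    by (intro integral_mono_AE Bochner_Integration.integrable_diff Bochner_Integration.integrable_add
        Bochner_Integration.integrable_divide integrable_mult_right) auto
  also have "\<dots> = (\<integral>\<omega>. ?G \<omega> \<partial>M) / (2 * Cg) + Cg * Lf\<^sup>2 / 2 * (\<integral>\<omega>. (norm (err k \<omega>))\<^sup>2 \<partial>M)"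
    by (subst Bochner_Integration.integral_add)
      (use op_norm_grad_F_moment(1)[of k] int_err in auto)
  also have "(\<integral>\<omega>. ?G \<omega> \<partial>M) / (2 * Cg) \<le> Cg * (\<integral>\<omega>. (norm (grad F (x k \<omega>)))\<^sup>2 \<partial>M) / (2 * Cg)"
    using constants_pos by (intro divide_right_mono op_norm_grad_F_moment) auto
  also have "\<dots> = (\<integral>\<omega>. (norm (grad F (x k \<omega>)))\<^sup>2 \<partial>M) / 2"
    using constants_pos by simp
  finally show "(\<integral>\<omega>. (norm (grad F (x k \<omega>)))\<^sup>2 \<partial>M) / 2 - Cg * Lf\<^sup>2 / 2 * (\<integral>\<omega>. (norm (err k \<omega>))\<^sup>2 \<partial>M)
    \<le> (\<integral>\<omega>. inner (grad F (x k \<omega>)) (dir k \<omega>) \<partial>M)"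
    using int by (simp add: inner_grad_F_dir_exact)
qed

text \<open>Two-sided because it serves twice: the absolute value propagates integrability of
  \<open>F (x k \<omega>)\<close>, and the upper half yields the descent.\<close>

lemma F_step:
  assumes "\<omega> \<in> space M"
  shows "\<bar>F (x (Suc k) \<omega>) - F (x k \<omega>) + \<alpha> k * inner (grad F (x k \<omega>)) (dir k \<omega>)\<bar>
    \<le> LF * (\<alpha> k)\<^sup>2 * (norm (dir k \<omega>))\<^sup>2"
proof -
  have x: "x (Suc k) \<omega> - x k \<omega> = - \<alpha> k *\<^sub>R dir k \<omega>"
    using x_Suc[OF assms, of k] by (simp add: dir_def)
  have "\<bar>F (x (Suc k) \<omega>) - F (x k \<omega>) - inner (grad F (x k \<omega>)) (x (Suc k) \<omega> - x k \<omega>)\<bar>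
      \<le> LF * (norm (x (Suc k) \<omega> - x k \<omega>))\<^sup>2"
    using lipschitz_on_normD[OF gradF_lipschitz]
    by (intro grad_lipschitz_remainder_le F_differentiable LF_nonneg) auto
  then show ?thesis
    unfolding x by (simp add: power_mult_distrib mult.assoc)
qed

lemma F_integrable: "integrable M (\<lambda>\<omega>. F (x k \<omega>))"
proof (induction k)
  case 0
  have "integrable M (\<lambda>\<omega>. F (x 0 \<omega>)) \<longleftrightarrow> integrable M (\<lambda>\<omega>. F x0)"
    by (intro Bochner_Integration.integrable_cong) (auto simp: x_0)
  then show ?case
    by simp
next
  case (Suc k)
  let ?r = "\<lambda>\<omega>. F (x (Suc k) \<omega>) - F (x k \<omega>) + \<alpha> k * inner (grad F (x k \<omega>)) (dir k \<omega>)"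
  have "integrable M ?r"
  proof (rule Bochner_Integration.integrable_bound)
    show "integrable M (\<lambda>\<omega>. LF * (\<alpha> k)\<^sup>2 * (norm (dir k \<omega>))\<^sup>2)"
      using dir_moment(1)[of k] by simp
    show "AE \<omega> in M. norm (?r \<omega>) \<le> norm (LF * (\<alpha> k)\<^sup>2 * (norm (dir k \<omega>))\<^sup>2)"
      using F_step LF_nonneg by (intro AE_I2) simp
  qed measurable
  moreover have "integrable M (\<lambda>\<omega>. F (x k \<omega>) - \<alpha> k * inner (grad F (x k \<omega>)) (dir k \<omega>))"
    using Suc inner_grad_F_dir(1)[of k] by simp
  ultimately have "integrable M (\<lambda>\<omega>. ?r \<omega> + (F (x k \<omega>) - \<alpha> k * inner (grad F (x k \<omega>)) (dir k \<omega>)))"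
    by (rule Bochner_Integration.integrable_add)
  then show ?case
    by simp
qed

lemma descent:
  "\<alpha> k * (\<integral>\<omega>. (norm (grad F (x k \<omega>)))\<^sup>2 \<partial>M)
    \<le> 2 * ((\<integral>\<omega>. F (x k \<omega>) \<partial>M) - (\<integral>\<omega>. F (x (Suc k) \<omega>) \<partial>M)) + 2 * LF * Cg * Cf * (\<alpha> k)\<^sup>2
      + Cg * Lf\<^sup>2 * (\<alpha> k * (\<integral>\<omega>. (norm (err k \<omega>))\<^sup>2 \<partial>M))"
proof -
  let ?I = "\<integral>\<omega>. inner (grad F (x k \<omega>)) (dir k \<omega>) \<partial>M"
  have "(\<integral>\<omega>. F (x (Suc k) \<omega>) \<partial>M) \<le> (\<integral>\<omega>. F (x k \<omega>) - \<alpha> k * inner (grad F (x k \<omega>)) (dir k \<omega>)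
      + LF * (\<alpha> k)\<^sup>2 * (norm (dir k \<omega>))\<^sup>2 \<partial>M)"
  proof (rule integral_mono)
    show "F (x (Suc k) \<omega>) \<le> F (x k \<omega>) - \<alpha> k * inner (grad F (x k \<omega>)) (dir k \<omega>)
        + LF * (\<alpha> k)\<^sup>2 * (norm (dir k \<omega>))\<^sup>2" if "\<omega> \<in> space M" for \<omega>
      using F_step[OF that, of k] by linarith
  qed (use F_integrable inner_grad_F_dir(1)[of k] dir_moment(1)[of k] in auto)
  also have "\<dots> = (\<integral>\<omega>. F (x k \<omega>) \<partial>M) - \<alpha> k * ?I + LF * (\<alpha> k)\<^sup>2 * (\<integral>\<omega>. (norm (dir k \<omega>))\<^sup>2 \<partial>M)"
    using F_integrable[of k] inner_grad_F_dir(1)[of k] dir_moment(1)[of k] by simp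
  also have "LF * (\<alpha> k)\<^sup>2 * (\<integral>\<omega>. (norm (dir k \<omega>))\<^sup>2 \<partial>M) \<le> LF * (\<alpha> k)\<^sup>2 * (Cg * Cf)"
    using LF_nonneg by (intro mult_left_mono dir_moment) auto
  finally have 1: "(\<integral>\<omega>. F (x (Suc k) \<omega>) \<partial>M) \<le> (\<integral>\<omega>. F (x k \<omega>) \<partial>M) - \<alpha> k * ?I + LF * (\<alpha> k)\<^sup>2 * (Cg * Cf)"
    by simp
  have "\<alpha> k * ((\<integral>\<omega>. (norm (grad F (x k \<omega>)))\<^sup>2 \<partial>M) / 2 - Cg * Lf\<^sup>2 / 2 * (\<integral>\<omega>. (norm (err k \<omega>))\<^sup>2 \<partial>M)) \<le> \<alpha> k * ?I"
    using \<alpha>_pos[of k] by (intro mult_left_mono inner_grad_F_dir) auto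
  with 1 show ?thesis
    by (simp add: field_simps)
qed

end

section \<open>The deterministic rate\<close>

text \<open>By ln(1+t) <= t and exp(s) >= 1+s, passing from k to k+1 multiplies the power by at
  least 1 - (4/7)/k, and 1/k is at most the power itself because 4/7 < 1.\<close>

lemma powr_decrement_le:
  assumes "1 \<le> (k :: nat)"
  shows "real k powr (- 4 / 7) - 4 / 7 * (real k powr (- 4 / 7))\<^sup>2 \<le> real (Suc k) powr (- 4 / 7)"
proof -
  define b where "b = real k powr (- 4 / 7)"
  have k: "0 < real k"
    using assms by simp
  have b: "0 < b" "1 / real k \<le> b"
    using assms powr_mono[of "-1" "- 4 / 7" "real k"] by (auto simp: b_def powr_minus_divide)
  have "ln (1 + 1 / real k) \<le> 1 / real k"
    using k by (intro ln_add_one_self_le_self) simp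
  also have "\<dots> \<le> b"
    by (rule b)
  finally have "1 - 4 / 7 * b \<le> 1 + (- 4 / 7) * ln (1 + 1 / real k)"
    by simp
  also have "\<dots> \<le> exp ((- 4 / 7) * ln (1 + 1 / real k))"
    by (rule exp_ge_add_one_self)
  also have "\<dots> = (1 + 1 / real k) powr (- 4 / 7)"
    using add_pos_pos[of 1 "1 / real k"] k by (simp add: powr_def)
  finally have "b * (1 - 4 / 7 * b) \<le> b * (1 + 1 / real k) powr (- 4 / 7)"
    using b by (intro mult_left_mono) auto
  also have "\<dots> = (real k * (1 + 1 / real k)) powr (- 4 / 7)"
    using k by (simp add: b_def powr_mult)
  also have "real k * (1 + 1 / real k) = real (Suc k)"
    using k by (simp add: field_simps)
  finally show ?thesis
    by (simp add: b_def power2_eq_square algebra_simps)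
qed

text \<open>Here \<open>a\<close> stands for E|e(k)|^2, \<open>b\<close> for E|grad F(x(k))|^2 and
  \<open>\<Phi>\<close> for E F(x(k)). Sums and inductions start at 1, since the stepsizes of index
  0 do not follow the power law.\<close>

lemma accelerated_rate:
  fixes a b \<Phi> \<alpha> \<beta> :: "nat \<Rightarrow> real"
  assumes \<alpha>: "\<And>k. 1 \<le> k \<Longrightarrow> \<alpha> k = real k powr (- 5 / 7)"
    and \<beta>: "\<And>k. 1 \<le> k \<Longrightarrow> \<beta> k = real k powr (- 4 / 7)"
    and rec: "\<And>k. a (Suc k) \<le> (1 - \<beta> k) * a k + C1 * (\<alpha> k ^ 4 / \<beta> k ^ 3) + (\<beta> k)\<^sup>2 * C0"
    and desc: "\<And>k. \<alpha> k * b k \<le> 2 * (\<Phi> k - \<Phi> (Suc k)) + C2 * (\<alpha> k)\<^sup>2 + C3 * (\<alpha> k * a k)"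
    and nonneg: "0 \<le> C0" "0 \<le> C1" "0 \<le> C2" "0 \<le> C3"
    and m: "\<And>k. m \<le> \<Phi> k"
  shows "\<exists>c>0. \<forall>\<epsilon>. 0 < \<epsilon> \<and> \<epsilon> \<le> 1 \<longrightarrow> (\<exists>k. real k \<le> c * \<epsilon> powr (- 7 / 2) \<and> b k \<le> \<epsilon>)"
proof -
  \<comment> \<open>\<open>a 1\<close> covers the base case, as \<open>\<beta> 1 = 1\<close>. The
    factor 7/3 makes \<open>C0 + C1\<close> at most (3/7) A, the share left by the decrement 4/7 of
    \<open>\<beta>\<close>.\<close>
  define A where "A = max (a 1) (7 / 3 * (C0 + C1))"
  have A: "a 1 \<le> A" "7 / 3 * (C0 + C1) \<le> A" "0 \<le> A"
    using nonneg by (auto simp: A_def le_max_iff_disj)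
  have a_le: "a k \<le> A * \<beta> k" if "1 \<le> k" for k
    using that
  proof (induction k rule: dec_induct)
    case base
    then show ?case
      using A by (simp add: \<beta>)
  next
    case (step k)
    have k: "1 \<le> k" "0 < real k"
      using step by auto
    have "\<beta> k \<le> 1"
      using k powr_mono[of "- 4 / 7" 0 "real k"] by (simp add: \<beta>)
    have "\<alpha> k ^ 4 / \<beta> k ^ 3 = (\<beta> k)\<^sup>2"
      using k by (simp add: \<alpha> \<beta> powr_power flip: powr_diff)
    then have "a (Suc k) \<le> (1 - \<beta> k) * a k + (C0 + C1) * (\<beta> k)\<^sup>2"
      using rec[of k] by (simp add: algebra_simps)
    also have "\<dots> \<le> (1 - \<beta> k) * (A * \<beta> k) + 3 / 7 * A * (\<beta> k)\<^sup>2"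
      using step.IH \<open>\<beta> k \<le> 1\<close> A by (intro add_mono mult_left_mono mult_right_mono) auto
    also have "\<dots> = A * (\<beta> k - 4 / 7 * (\<beta> k)\<^sup>2)"
      by (simp add: algebra_simps power2_eq_square)
    also have "\<dots> \<le> A * \<beta> (Suc k)"
      using k A powr_decrement_le[of k] by (intro mult_left_mono) (auto simp: \<beta>)
    finally show ?case .
  qed
  \<comment> \<open>The exponent is that of \<open>\<alpha> k * \<beta> k\<close>; it also dominates
    \<open>(\<alpha> k)\<^sup>2\<close>, whose exponent is -10/7.\<close>
  define s where "s k = real k powr (- 9 / 7)" for k
  have s: "summable s" "\<And>k. 0 \<le> s k"
    using summable_real_powr_iff[of "- 9 / 7"] by (auto simp: s_def[abs_def])
  define B where "B = max 1 (2 * (\<Phi> 1 - m) + (C2 + C3 * A) * suminf s)"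
  have B: "1 \<le> B" "2 * (\<Phi> 1 - m) + (C2 + C3 * A) * suminf s \<le> B"
    by (auto simp: B_def)
  have sum_le: "(\<Sum>k\<in>{1..<Suc K}. \<alpha> k * b k) \<le> B" for K
  proof -
    have step: "\<alpha> k * b k \<le> 2 * (\<Phi> k - \<Phi> (Suc k)) + (C2 + C3 * A) * s k" if "1 \<le> k" for k
    proof -
      have k: "1 \<le> real k"
        using that by simp
      have "(\<alpha> k)\<^sup>2 \<le> s k"
        using k by (auto simp: \<alpha>[OF that] s_def powr_power intro!: powr_mono)
      moreover have "\<alpha> k * a k \<le> \<alpha> k * (A * \<beta> k)"
        using a_le[OF that] by (intro mult_left_mono) (simp_all add: \<alpha>[OF that])
      moreover have "\<alpha> k * (A * \<beta> k) = A * s k"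
        using k by (simp add: \<alpha>[OF that] \<beta>[OF that] s_def flip: powr_add)
      ultimately have "C2 * (\<alpha> k)\<^sup>2 + C3 * (\<alpha> k * a k) \<le> C2 * s k + C3 * (A * s k)"
        using nonneg by (intro add_mono mult_left_mono) auto
      then show ?thesis
        using desc[of k] by (simp add: algebra_simps)
    qed
    have tele: "(\<Sum>k\<in>{1..<Suc K}. \<Phi> k - \<Phi> (Suc k)) = \<Phi> 1 - \<Phi> (Suc K)"
      by (induction K) auto
    have "(\<Sum>k\<in>{1..<Suc K}. \<alpha> k * b k) \<le> (\<Sum>k\<in>{1..<Suc K}. 2 * (\<Phi> k - \<Phi> (Suc k)) + (C2 + C3 * A) * s k)"
      by (intro sum_mono step) auto
    also have "\<dots> = 2 * (\<Phi> 1 - \<Phi> (Suc K)) + (C2 + C3 * A) * (\<Sum>k\<in>{1..<Suc K}. s k)"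
      by (simp only: sum.distrib sum_distrib_left[symmetric] tele)
    also have "\<dots> \<le> 2 * (\<Phi> 1 - m) + (C2 + C3 * A) * suminf s"
      using nonneg A m[of "Suc K"] s
      by (intro add_mono mult_left_mono sum_le_suminf) auto
    also have "\<dots> \<le> B"
      by (rule B)
    finally show ?thesis .
  qed
  \<comment> \<open>The extra 1 in the constant pays for rounding \<open>X\<close> up to
    \<open>K\<close>, since \<open>\<epsilon> powr (- 7 / 2)\<close> is at least 1.\<close>
  have "\<exists>k. real k \<le> (B powr (7 / 2) + 1) * \<epsilon> powr (- 7 / 2) \<and> b k \<le> \<epsilon>" if \<epsilon>: "0 < \<epsilon>" "\<epsilon> \<le> 1" for \<epsilon>
  proof -
    \<comment> \<open>Solves \<epsilon> X^(2/7) = B: if every \<open>b k\<close> up to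
      \<open>K\<close> exceeded \<open>\<epsilon>\<close>, the weighted sum would exceed its bound
      \<open>B\<close>.\<close>
    define X where "X = (B / \<epsilon>) powr (7 / 2)"
    define K where "K = nat \<lceil>X\<rceil>"
    have "0 < X"
      using B \<epsilon> by (simp add: X_def)
    then have K: "X \<le> real K" "real K \<le> X + 1" "1 \<le> K"
      unfolding K_def by linarith+
    have X: "X = B powr (7 / 2) * \<epsilon> powr (- 7 / 2)"
      using B \<epsilon> by (simp add: X_def powr_divide powr_minus_divide)
    have "1 \<le> \<epsilon> powr (- 7 / 2)"
      using \<epsilon> powr_mono'[of "- 7 / 2" 0 \<epsilon>] by simp
    then have K_le: "real K \<le> (B powr (7 / 2) + 1) * \<epsilon> powr (- 7 / 2)"
      using K X by (simp add: algebra_simps)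
    have "\<exists>k\<in>{1..<Suc K}. b k \<le> \<epsilon>"
    proof (rule ccontr)
      assume "\<not> ?thesis"
      then have gt: "\<epsilon> < b k" if "k \<in> {1..<Suc K}" for k
        using that by force
      have "B = \<epsilon> * X powr (2 / 7)"
        using B \<epsilon> by (simp add: X_def powr_powr)
      also have "\<dots> \<le> \<epsilon> * real K powr (2 / 7)"
        using \<epsilon> K \<open>0 < X\<close> by (intro mult_left_mono powr_mono2) auto
      \<comment> \<open>K^(2/7) is split into K equal terms K^(-5/7), each at most
        \<open>\<alpha> k\<close> for k up to K.\<close>
      also have "real K powr (2 / 7) = (\<Sum>k\<in>{1..<Suc K}. real K powr (- 5 / 7))"
        using K powr_add[of "real K" 1 "- 5 / 7"] by simp
      also have "\<dots> \<le> (\<Sum>k\<in>{1..<Suc K}. \<alpha> k)"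
        using K by (intro sum_mono) (auto simp: \<alpha> intro!: powr_mono2')
      also have "\<epsilon> * (\<Sum>k\<in>{1..<Suc K}. \<alpha> k) = (\<Sum>k\<in>{1..<Suc K}. \<alpha> k * \<epsilon>)"
        by (simp only: sum_distrib_left mult.commute)
      also have "\<dots> < (\<Sum>k\<in>{1..<Suc K}. \<alpha> k * b k)"
        using K gt by (intro sum_strict_mono) (auto simp: \<alpha> intro!: mult_strict_left_mono)
      finally show False
        using sum_le[of K] \<epsilon> by simp
    qed
    then obtain k where "k \<in> {1..<Suc K}" and k: "b k \<le> \<epsilon>"
      by (elim bexE)
    then have "k \<le> K"
      by (simp only: atLeastLessThan_iff less_Suc_eq_le)
    then have "real k \<le> (B powr (7 / 2) + 1) * \<epsilon> powr (- 7 / 2)"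
      using K_le by simp
    with k show ?thesis
      by blast
  qed
  moreover have "0 < B powr (7 / 2) + 1"
    by (simp add: add_nonneg_pos)
  ultimately show ?thesis
    by blast
qed

section \<open>From the rate to the hitting time\<close>

theorem theorem15:
  fixes M :: "'a measure" and W :: "'w measure" and V :: "'v measure"
    and w :: "nat \<Rightarrow> 'a \<Rightarrow> 'w" and v :: "nat \<Rightarrow> 'a \<Rightarrow> 'v"
    and gw :: "'w \<Rightarrow> real ^ 'n \<Rightarrow> real ^ 'm" and fv :: "'v \<Rightarrow> real ^ 'm \<Rightarrow> real"
    and g :: "real ^ 'n \<Rightarrow> real ^ 'm" and f :: "real ^ 'm \<Rightarrow> real" and F :: "real ^ 'n \<Rightarrow> real"
    and Cg Cf Vg Lf LF :: real and \<alpha> \<beta> :: "nat \<Rightarrow> real"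
    and x0 :: "real ^ 'n" and y0 :: "real ^ 'm"
    and x z :: "nat \<Rightarrow> 'a \<Rightarrow> real ^ 'n" and y :: "nat \<Rightarrow> 'a \<Rightarrow> real ^ 'm"
  assumes "composition_problem M W V w v gw fv g f"
    and "\<And>u. F u = f (g u)"
    and "scgd_assumption1 M W V w v gw fv g f Cg Cf Vg Lf"
    and "scgd_assumption2 M W V w v gw fv g Cg Cf"
    and "LF-lipschitz_on UNIV (grad F)"
    and "0 < \<alpha> 0" "\<alpha> 0 \<le> 1" "0 < \<beta> 0" "\<beta> 0 \<le> 1"
    and "\<And>k. 1 \<le> k \<Longrightarrow> \<alpha> k = real k powr (- 5 / 7)"
    and "\<And>k. 1 \<le> k \<Longrightarrow> \<beta> k = real k powr (- 4 / 7)"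
    and "accelerated_scgd M w v gw fv \<alpha> \<beta> x0 y0 x y z"
  shows "\<exists>c > 0. \<forall>\<epsilon>. 0 < \<epsilon> \<and> \<epsilon> \<le> 1 \<longrightarrow>
           ereal_of_enat (T_eps M F x \<epsilon>) \<le> ereal (c * \<epsilon> powr (- 7 / 2))"
proof -
  \<comment> \<open>Index 0 is treated apart: the power formula would give the value 0 there, while
    \<open>\<alpha> 0\<close> is an arbitrary positive number.\<close>
  have \<alpha>: "0 < \<alpha> k" for k
    using assms(6) assms(10)[of k] by (cases "k = 0") auto
  have \<beta>: "0 < \<beta> k \<and> \<beta> k \<le> 1" for k
    using assms(8,9) assms(11)[of k] powr_mono[of "- 4 / 7" 0 "real k"] by (cases "k = 0") auto
  interpret accelerated_scgd_setup M W V w v gw fv g f F Cg Cf Vg Lf LF \<alpha> \<beta> x0 y0 x z y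
    by unfold_locales (use assms \<alpha> \<beta> in auto)
  let ?b = "\<lambda>k. \<integral>\<omega>. (norm (grad F (x k \<omega>)))\<^sup>2 \<partial>M"
  obtain C where C: "0 \<le> C" "\<And>k. (\<integral>\<omega>. (norm (err (Suc k) \<omega>))\<^sup>2 \<partial>M)
      \<le> (1 - \<beta> k) * (\<integral>\<omega>. (norm (err k \<omega>))\<^sup>2 \<partial>M) + C * (\<alpha> k ^ 4 / \<beta> k ^ 3) + (\<beta> k)\<^sup>2 * Vg"
    using err_recursion by blast
  obtain m where m: "\<And>u. m \<le> F u"
    using F_bounded_below by blast
  have m_le: "m \<le> (\<integral>\<omega>. F (x k \<omega>) \<partial>M)" for k
    using integral_ge_const[OF F_integrable] m by simp
  \<comment> \<open>The instance has \<open>C0 = Vg\<close>, \<open>C1 = C\<close>,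
    \<open>C2 = 2 * LF * Cg * Cf\<close> and C3 = Cg Lf^2; none of these, nor \<open>m\<close>,
    involves \<open>\<epsilon>\<close>, so neither does \<open>c\<close>.\<close>
  obtain c where c: "0 < c" "\<And>\<epsilon>. 0 < \<epsilon> \<and> \<epsilon> \<le> 1 \<Longrightarrow> \<exists>k. real k \<le> c * \<epsilon> powr (- 7 / 2) \<and> ?b k \<le> \<epsilon>"
    using accelerated_rate[OF assms(10,11) C(2) descent _ C(1) _ _ m_le] constants_pos LF_nonneg by auto
  show ?thesis
  proof (intro exI conjI allI impI)
    show "0 < c"
      by (rule c)
    fix \<epsilon> :: real assume \<epsilon>: "0 < \<epsilon> \<and> \<epsilon> \<le> 1"
    then obtain k where k: "real k \<le> c * \<epsilon> powr (- 7 / 2)" "?b k \<le> \<epsilon>"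
      using c(2) by blast
    \<comment> \<open>The infimum up to \<open>k\<close> lies below its last term, so
      \<open>k\<close> itself belongs to the set that defines \<open>T_eps\<close>.\<close>
    have "(INF t\<in>{0..k}. \<integral>\<^sup>+\<omega>. ennreal ((norm (grad F (x t \<omega>)))\<^sup>2) \<partial>M)
        \<le> (\<integral>\<^sup>+\<omega>. ennreal ((norm (grad F (x k \<omega>)))\<^sup>2) \<partial>M)"
      by (rule INF_lower) simp
    also have "\<dots> = ennreal (?b k)"
      by (simp add: nn_integral_eq_integral grad_F_moment)
    also have "\<dots> \<le> ennreal \<epsilon>"
      using k by (intro ennreal_leI)
    finally have "T_eps M F x \<epsilon> \<le> enat k"
      unfolding T_eps_def by (intro Inf_lower) auto
    then have "ereal_of_enat (T_eps M F x \<epsilon>) \<le> ereal (real k)"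
      using ereal_of_enat_le_iff[of _ "enat k"] by simp
    also have "\<dots> \<le> ereal (c * \<epsilon> powr (- 7 / 2))"
      using k by simp
    finally show "ereal_of_enat (T_eps M F x \<epsilon>) \<le> ereal (c * \<epsilon> powr (- 7 / 2))" .
  qed
qed

end
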